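(* Let $q>2$, $k\mid n$, and let $\mathcal S$ be a set of $q^k+1$ elements of $\mathcal D$. The following are equivalent: (1) $\mathcal S=\phi(m)$ for some $\mathbb{F}_{q^k}$-subline $m$ contained in $l_\infty$; (2) for any three elements of $\mathcal S$, the unique regulus containing them is contained in $\mathcal S$; (3) there is a $(2k-1)$-dimensional subspace of $H_\infty$ meeting each element of $\mathcal S$ in a $(k-1)$-dimensional subspace; (4) there is a $(2k-1)$-dimensional subspace of $H_\infty$ meeting each element of $\mathcal S$ in a $(k-1)$-dimensional subspace belonging to $\mathcal D_k$.
   Context: Let $q$ be a prime power and $n\ge1$. Points of $\mathrm{PG}(2,q^n)$ are written $(a,b,c)_{\mathbb{F}_{q^n}}$; $l_\infty$ is the line $c=0$. An $\mathbb{F}_{q^k}$-subline ($k\mid n$) is a set $\{(su+tv)_{\mathbb{F}_{q^n}}:(s,t)\in\mathbb{F}_{q^k}^2\setminus\{(0,0)\}\}$ for $\mathbb{F}_{q^n}$-independent $u,v\in\mathbb{F}_{q^n}^3$. Let $H_\infty=\mathrm{PG}(2n-1,q)$ be the projective space of the $\mathbb{F}_q$-vector space $\mathbb{F}_{q^n}^2$, points $(a,b,0)_{\mathbb{F}_q}$. For $k\mid n$, $\mathcal D_k=\{\{(ax,bx,0)_{\mathbb{F}_q}:x\in\mathbb{F}_{q^k}^*\}:(a,b)\in\mathbb{F}_{q^n}^2\setminus\{(0,0)\}\}$ and $\mathcal D=\mathcal D_n$ (a Desarguesian $(n-1)$-spread). The map $\phi$ sends a point $(a,b,0)_{\mathbb{F}_{q^n}}$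 of $l_\infty$ to $\{(ax,bx,0)_{\mathbb{F}_q}:x\in\mathbb{F}_{q^n}^*\}\in\mathcal D$. A regulus is a set $\mathcal R$ of $(n-1)$-spaces in a $(2n-1)$-space such that every line meeting three elements of $\mathcal R$ meets all elements of $\mathcal R$; any three pairwise disjoint $(n-1)$-spaces spanning a $(2n-1)$-space lie in a unique regulus of $q+1$ elements. *)

theory Defs
  imports Main "HOL-Computational_Algebra.Primes"
begin

text \<open>The field F_{q^n} is a finite field type 'a with CARD('a) = q^n.
 Its subfield F_{q^k} (k dvd n) is the set of roots of x^(q^k) = x.
 The F_q-vector space F_{q^n}^2 underlying H_inf = PG(2n-1,q) is 'a \<times> 'a.
 A projective subspace of H_inf is represented by its underlying F_q-vector subspace
 (a set of vectors containing 0); projective dimension d = vector dimension d+1.\<close>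

definition subfld :: "nat \<Rightarrow> nat \<Rightarrow> 'a::{field,finite} set" where
  "subfld q k = {x. x ^ (q ^ k) = x}"

definition sc :: "'a::field \<Rightarrow> 'a \<times> 'a \<Rightarrow> 'a \<times> 'a" where
  "sc c v = (c * fst v, c * snd v)"

definition vadd :: "'a::field \<times> 'a \<Rightarrow> 'a \<times> 'a \<Rightarrow> 'a \<times> 'a" where
  "vadd v w = (fst v + fst w, snd v + snd w)"

definition lcomb :: "'a::field list \<Rightarrow> ('a \<times> 'a) list \<Rightarrow> 'a \<times> 'a" where
  "lcomb cs vs = foldr vadd (map2 sc cs vs) (0, 0)"

definition fspan :: "'a::field set \<Rightarrow> ('a \<times> 'a) list \<Rightarrow> ('a \<times> 'a) set" where
  "fspan F vs = {lcomb cs vs | cs. length cs = length vs \<and> set cs \<subseteq> F}"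

definition findep :: "'a::field set \<Rightarrow> ('a \<times> 'a) list \<Rightarrow> bool" where
  "findep F vs = (\<forall>cs. length cs = length vs \<and> set cs \<subseteq> F \<and> lcomb cs vs = (0, 0)
                   \<longrightarrow> (\<forall>c\<in>set cs. c = 0))"

definition fdim :: "'a::field set \<Rightarrow> ('a \<times> 'a) set \<Rightarrow> nat \<Rightarrow> bool" where
  "fdim F W d = (\<exists>vs. length vs = d \<and> findep F vs \<and> fspan F vs = W)"

definition Dspread :: "nat \<Rightarrow> nat \<Rightarrow> ('a::{field,finite} \<times> 'a) set set" where
  "Dspread q k = {{(a * x, b * x) | x. x \<in> subfld q k} | a b. (a, b) \<noteq> (0, 0)}"

definition meets :: "('a::field \<times> 'a) set \<Rightarrow> ('a \<times> 'a) set \<Rightarrow> bool" where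
  "meets X Y = (X \<inter> Y \<noteq> {(0, 0)})"

definition is_regulus :: "nat \<Rightarrow> nat \<Rightarrow> ('a::{field,finite} \<times> 'a) set set \<Rightarrow> bool" where
  "is_regulus q n R =
     (card R = q + 1 \<and>
      (\<forall>X\<in>R. fdim (subfld q 1) X n) \<and>
      (\<forall>X\<in>R. \<forall>Y\<in>R. X \<noteq> Y \<longrightarrow> X \<inter> Y = {(0, 0)}) \<and>
      (\<forall>L. fdim (subfld q 1) L 2 \<longrightarrow>
          (\<exists>A\<in>R. \<exists>B\<in>R. \<exists>C\<in>R. A \<noteq> B \<and> A \<noteq> C \<and> B \<noteq> C \<and> meets L A \<and> meets L B \<and> meets L C)
          \<longrightarrow> (\<forall>X\<in>R. meets L X)))"

definition sc3 :: "'a::field \<Rightarrow> 'a \<times> 'a \<times> 'a \<Rightarrow> 'a \<times> 'a \<times> 'a" where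
  "sc3 c w = (c * fst w, c * fst (snd w), c * snd (snd w))"

definition vadd3 :: "'a::field \<times> 'a \<times> 'a \<Rightarrow> 'a \<times> 'a \<times> 'a \<Rightarrow> 'a \<times> 'a \<times> 'a" where
  "vadd3 v w = (fst v + fst w, fst (snd v) + fst (snd w), snd (snd v) + snd (snd w))"

definition ppt :: "'a::field \<times> 'a \<times> 'a \<Rightarrow> ('a \<times> 'a \<times> 'a) set" where
  "ppt w = {sc3 c w | c. c \<noteq> 0}"

definition l_inf :: "('a::field \<times> 'a \<times> 'a) set set" where
  "l_inf = {ppt (a, b, 0) | a b. (a, b) \<noteq> (0, 0)}"

definition is_subline :: "nat \<Rightarrow> nat \<Rightarrow> ('a::{field,finite} \<times> 'a \<times> 'a) set set \<Rightarrow> bool" where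
  "is_subline q k m =
     (\<exists>u v. (\<forall>\<alpha> \<beta>. vadd3 (sc3 \<alpha> u) (sc3 \<beta> v) = (0, 0, 0) \<longrightarrow> \<alpha> = 0 \<and> \<beta> = 0) \<and>
        m = {ppt (vadd3 (sc3 s u) (sc3 t v)) | s t.
               s \<in> subfld q k \<and> t \<in> subfld q k \<and> (s, t) \<noteq> (0, 0)})"

definition phi :: "('a::field \<times> 'a \<times> 'a) set \<Rightarrow> ('a \<times> 'a) set" where
  "phi P = {(a * x, b * x) | a b c x. (a, b, c) \<in> P}"

end

theory Submission
  imports Defs "HOL-Computational_Algebra.Polynomial" "HOL-Library.Product_Plus"
begin

text \<open>Elements of \<open>\<D>\<close> are the lines \<open>fline v\<close> through the origin of \<open>F\<^sup>2\<close>, \<open>F = F\<^bsub>q^n\<^esub>\<close>, so (1) says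
  that \<open>\<S>\<close> is an \<open>F\<^bsub>q^k\<^esub>\<close>-subline of \<open>PG(1, q^n)\<close>. Given (1), (4)
  and hence (3) hold for the \<open>F\<^bsub>q^k\<^esub>\<close>-span of a frame of the subline.
  The regulus through three elements of \<open>\<D>\<close> is the \<open>F\<^sub>q\<close>-subline through them, so (2) means that \<open>\<S>\<close>
  is closed under \<open>F\<^sub>q\<close>-sublines. Given (3), a count shows that the elements of \<open>\<S>\<close> partition the
  nonzero vectors of \<open>W\<close>; for \<open>Fa\<close>, \<open>Fb\<close>, \<open>F(a + b)\<close> in \<open>\<S>\<close> some \<open>\<gamma>a\<close> and \<open>\<gamma>b\<close> with \<open>\<gamma> \<noteq> 0\<close> lie in \<open>W\<close>,
  and hence so does a nonzero vector of each point of their \<open>F\<^sub>q\<close>-subline.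
  Given (2), normalise so that \<open>\<infinity>, 0, 1 \<in> \<S>\<close> and let \<open>T = \<S> - {\<infinity>}\<close>. As \<open>q > 2\<close>, the sublines through
  \<open>\<infinity>\<close> make \<open>T\<close> an additive group, and those through \<open>0\<close> give \<open>xy/(x + y) \<in> T\<close>. An argument
  in the style of Hua's identity then makes \<open>T\<close> multiplicatively closed, hence the subfield of order \<open>q^k\<close>.\<close>

section \<open>Finite fields and their subfields\<close>

text \<open>Multiplication by a nonzero \<open>x\<close> permutes \<open>T - {0}\<close>; comparing
  products of all elements gives \<open>x ^ card (T - {0}) = 1\<close>. Besides
  \<open>T = UNIV\<close>, this serves to place a multiplicatively closed set of
  \<open>q ^ k\<close> elements inside \<open>subfld q k\<close>.\<close>

lemma power_card_mult_closed:
  fixes T :: "'a::{field,finite} set"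
  assumes mult: "\<And>x y. x \<in> T \<Longrightarrow> y \<in> T \<Longrightarrow> x * y \<in> T" and "0 \<in> T" and "x \<in> T"
  shows "x ^ card T = x"
proof (cases "x = 0")
  case True
  then show ?thesis using \<open>0 \<in> T\<close> by (auto simp: power_0_left card_gt_0_iff)
next
  case False
  let ?U = "T - {0}"
  have inj: "inj_on ((*) x) ?U" using False by (auto simp: inj_on_def)
  have "(*) x ` ?U \<subseteq> ?U" using mult assms(3) False by auto
  with inj have im: "(*) x ` ?U = ?U" by (simp add: endo_inj_surj)
  have "(\<Prod>y\<in>?U. y) = (\<Prod>y\<in>?U. x * y)"
    using prod.reindex[OF inj, of "\<lambda>y. y"] im by simp
  also have "\<dots> = x ^ card ?U * (\<Prod>y\<in>?U. y)" by (simp add: prod.distrib)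
  finally have "x ^ card ?U = 1" by simp
  moreover have "card T = Suc (card ?U)"
    using \<open>0 \<in> T\<close> by (metis card_Suc_Diff1 finite_code)
  ultimately show ?thesis by simp
qed

lemma power_card_UNIV:
  fixes x :: "'a::{field,finite}"
  shows "x ^ card (UNIV :: 'a set) = x"
  by (rule power_card_mult_closed) auto

text \<open>The polynomial \<open>X^M - 1\<close> divides \<open>X^(M j) - 1\<close>, which vanishes
  at every nonzero element. The cofactor \<open>h\<close> accounts for at most
  \<open>M j - M\<close> of these \<open>M j\<close> roots, so at least \<open>M\<close> are left
  for \<open>X^M - 1\<close>.\<close>

lemma card_roots_of_unity_eq:
  fixes M j :: nat
  assumes card: "card (UNIV :: 'a::{field,finite} set) = Suc (M * j)" and "M * j > 0"
  shows "card {x::'a. x ^ M = 1} = M"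
proof -
  have pos: "M > 0" "j > 0" using assms(2) by auto
  let ?f = "monom 1 M - 1 :: 'a poly"
  let ?g = "monom 1 (M * j) - 1 :: 'a poly"
  have deg: "degree (monom 1 m - 1 :: 'a poly) = m" if "m > 0" for m
    using that degree_add_eq_left[of "- 1" "monom 1 m :: 'a poly"] by (simp add: degree_monom_eq)
  have f0: "?f \<noteq> 0" and g0: "?g \<noteq> 0" using deg[of M] deg[of "M * j"] assms(2) pos by fastforce+
  have "?g = monom 1 M ^ j - 1" by (simp add: monom_power)
  then have "?f dvd ?g" by (simp add: power_diff_1_eq)
  then obtain h where h: "?g = ?f * h" by auto
  with g0 have h0: "h \<noteq> 0" by auto
  have degs: "M * j = M + degree h"
    using h deg[of M] deg[of "M * j"] assms(2) pos degree_mult_eq[OF f0 h0] by simp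
  have "UNIV - {0} \<subseteq> {x. poly ?f x = 0} \<union> {x. poly h x = 0}"
  proof
    fix x :: 'a assume "x \<in> UNIV - {0}"
    moreover have "x * x ^ (M * j) = x * 1" using power_card_UNIV[of x] card by simp
    ultimately have "poly ?g x = 0" by (simp add: poly_monom)
    then show "x \<in> {x. poly ?f x = 0} \<union> {x. poly h x = 0}" unfolding h by auto
  qed
  from card_mono[OF _ this] have "M * j \<le> card ({x. poly ?f x = 0} \<union> {x. poly h x = 0})"
    using card by (simp add: card_Diff_singleton)
  also have "\<dots> \<le> card {x. poly ?f x = 0} + degree h"
    using card_Un_le[of "{x. poly ?f x = 0}" "{x. poly h x = 0}"] card_poly_roots_bound[OF h0] by linarith
  finally have "M \<le> card {x. poly ?f x = 0}" using degs by simp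
  moreover have "card {x. poly ?f x = 0} \<le> M"
    using card_poly_roots_bound[OF f0] deg[of M] pos by simp
  ultimately show ?thesis by (simp add: poly_monom)
qed

lemma pred_dvd_power_pred: "(q ^ k - 1 :: nat) dvd q ^ (k * m) - 1"
proof (cases "q = 0")
  case False
  then have "int (q ^ (k * m) - 1) = int q ^ (k * m) - 1" "int (q ^ k - 1) = int q ^ k - 1"
    by (simp_all add: of_nat_diff)
  moreover have "(int q ^ k - 1) dvd (int q ^ k) ^ m - 1" by (simp add: power_diff_1_eq)
  ultimately show ?thesis by (metis int_dvd_int_iff power_mult)
qed (auto simp: power_0_left)

text \<open>The nonzero elements are the solutions of \<open>x ^ (q ^ k - 1) = 1\<close>, and
  \<open>q ^ k - 1\<close> divides \<open>q ^ n - 1\<close>, the order of the multiplicative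
  group.\<close>

lemma card_subfld:
  assumes card: "card (UNIV :: 'a::{field,finite} set) = q ^ n" and "q > 1" "k dvd n" "n \<ge> 1"
  shows "card (subfld q k :: 'a set) = q ^ k"
proof -
  obtain m where m: "n = k * m" using \<open>k dvd n\<close> by auto
  have qn: "q ^ n > 1" and qk: "q ^ k > 1" using assms m one_less_power[of q n] one_less_power[of q k] by auto
  obtain j where j: "q ^ n - 1 = (q ^ k - 1) * j" using pred_dvd_power_pred[of q k m] m by auto
  have "card (UNIV :: 'a set) = Suc ((q ^ k - 1) * j)" "(q ^ k - 1) * j > 0"
    unfolding j[symmetric] using card qn by simp_all
  then have "card {x::'a. x ^ (q ^ k - 1) = 1} = q ^ k - 1"
    by (rule card_roots_of_unity_eq)
  moreover have "subfld q k = insert 0 {x::'a. x ^ (q ^ k - 1) = 1}"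
  proof -
    have "x ^ (q ^ k) = x * x ^ (q ^ k - 1)" for x :: 'a
      using qk by (metis power_minus_mult mult.commute less_trans zero_less_one)
    then show ?thesis unfolding subfld_def using qk by (auto simp: power_0_left)
  qed
  ultimately show ?thesis using qk by (simp add: power_0_left)
qed

lemma CHAR_prime_power_card:
  assumes "card (UNIV :: 'a::{field,finite} set) = p ^ m" "prime p"
  shows "CHAR('a) = p"
proof -
  \<comment> \<open>The shift by 1 permutes the field, so \<open>card UNIV\<close> copies of 1 sum
    to 0.\<close>
  have "(\<Sum>x\<in>(UNIV :: 'a set). x + 1) = (\<Sum>x\<in>UNIV. x)"
    by (rule sum.reindex_bij_witness[where i = "\<lambda>x. x - 1" and j = "\<lambda>x. x + 1"]) auto
  then have "of_nat (card (UNIV :: 'a set)) = (0 :: 'a)" by (simp add: sum.distrib)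
  then have "CHAR('a) dvd p ^ m" using assms by (simp only: of_nat_eq_0_iff_char_dvd)
  moreover have "prime CHAR('a)"
    by (rule prime_CHAR_semidom) (simp add: finite_imp_CHAR_pos)
  ultimately show ?thesis using assms(2) by (metis prime_dvd_power primes_dvd_imp_eq)
qed

text \<open>Since \<open>x / 0 = 0\<close>, the division clause at \<open>y = 0\<close> only asks
  for \<open>0 \<in> K\<close>.\<close>

definition is_subfield :: "'a::field set \<Rightarrow> bool" where
  "is_subfield K \<longleftrightarrow> 0 \<in> K \<and> 1 \<in> K \<and> (\<forall>x\<in>K. \<forall>y\<in>K. x + y \<in> K \<and> x - y \<in> K \<and> x * y \<in> K \<and> x / y \<in> K)"

text \<open>The map \<open>x \<mapsto> x ^ (q ^ k)\<close> is a power of the Frobenius map, and the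
  fixed points of a field endomorphism form a subfield.\<close>

lemma is_subfield_subfld:
  assumes "card (UNIV :: 'a::{field,finite} set) = q ^ n" "q = p ^ e" "prime p"
  shows "is_subfield (subfld q k :: 'a set)"
proof -
  have p: "p = CHAR('a)"
    using CHAR_prime_power_card[of p "e * n", where 'a = 'a] assms by (simp add: power_mult)
  have add: "(x + y) ^ (q ^ k) = x ^ (q ^ k) + y ^ (q ^ k)" for x y :: 'a
    by (rule freshmans_dream'[where n = "e * k"]) (use assms p in \<open>simp_all add: power_mult\<close>)
  have diff: "(x - y) ^ (q ^ k) = x ^ (q ^ k) - y ^ (q ^ k)" for x y :: 'a
    using add[of "x - y" y] by (simp add: algebra_simps)
  have "q ^ k > 0" using assms prime_gt_0_nat by simp
  then show ?thesis
    unfolding is_subfield_def subfld_def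
    by (auto simp: add diff power_mult_distrib power_divide power_0_left)
qed

section \<open>Subspaces and their cardinalities\<close>

lemma vadd_eq_plus: "vadd v w = v + w"
  by (simp add: vadd_def plus_prod_def)

lemma sc_add_left: "sc (a + b) v = sc a v + sc b v"
  and sc_add_right: "sc a (v + w) = sc a v + sc a w"
  and sc_diff_left: "sc (a - b) v = sc a v - sc b v"
  and sc_sc: "sc a (sc b v) = sc (a * b) v"
  and sc_0_left [simp]: "sc 0 v = 0"
  and sc_0_right [simp]: "sc a 0 = 0"
  and sc_1 [simp]: "sc 1 v = v"
  and sc_minus1: "sc (- 1) v = - v"
  by (auto simp: sc_def algebra_simps prod_eq_iff)

lemma sc_eq_0_iff [simp]: "sc a v = 0 \<longleftrightarrow> a = 0 \<or> v = 0"
  by (auto simp: sc_def prod_eq_iff)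

lemma lcomb_Nil [simp]: "lcomb [] [] = 0"
  and lcomb_Cons [simp]: "lcomb (c # cs) (v # vs) = sc c v + lcomb cs vs"
  by (simp_all add: lcomb_def vadd_eq_plus zero_prod_def)

lemma lcomb_add:
  "length cs = length vs \<Longrightarrow> length ds = length vs \<Longrightarrow>
    lcomb (map2 (+) cs ds) vs = lcomb cs vs + lcomb ds vs"
proof (induction vs arbitrary: cs ds)
  case (Cons v vs)
  then show ?case by (cases cs; cases ds) (auto simp: sc_add_left)
qed auto

lemma lcomb_diff:
  "length cs = length vs \<Longrightarrow> length ds = length vs \<Longrightarrow>
    lcomb (map2 (-) cs ds) vs = lcomb cs vs - lcomb ds vs"
proof (induction vs arbitrary: cs ds)
  case (Cons v vs)
  then show ?case by (cases cs; cases ds) (auto simp: sc_diff_left)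
qed auto

lemma lcomb_scale:
  "length cs = length vs \<Longrightarrow> lcomb (map ((*) c) cs) vs = sc c (lcomb cs vs)"
proof (induction vs arbitrary: cs)
  case (Cons v vs)
  then show ?case by (cases cs) (auto simp: sc_add_right sc_sc)
qed auto

lemma lcomb_replicate_0: "lcomb (replicate (length vs) 0) vs = 0"
  by (induction vs) auto

definition is_subspace :: "'a::field set \<Rightarrow> ('a \<times> 'a) set \<Rightarrow> bool" where
  "is_subspace K W \<longleftrightarrow> 0 \<in> W \<and> (\<forall>v\<in>W. \<forall>w\<in>W. v + w \<in> W) \<and> (\<forall>c\<in>K. \<forall>v\<in>W. sc c v \<in> W)"

lemma is_subspaceD:
  assumes "is_subspace K W"
  shows "0 \<in> W" "v \<in> W \<Longrightarrow> w \<in> W \<Longrightarrow> v + w \<in> W" "c \<in> K \<Longrightarrow> v \<in> W \<Longrightarrow> sc c v \<in> W"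
  using assms by (auto simp: is_subspace_def)

lemma is_subfieldD:
  assumes "is_subfield K"
  shows "0 \<in> K" "1 \<in> K" "x \<in> K \<Longrightarrow> y \<in> K \<Longrightarrow> x + y \<in> K" "x \<in> K \<Longrightarrow> y \<in> K \<Longrightarrow> x - y \<in> K"
    "x \<in> K \<Longrightarrow> y \<in> K \<Longrightarrow> x * y \<in> K" "x \<in> K \<Longrightarrow> y \<in> K \<Longrightarrow> x / y \<in> K"
  using assms by (auto simp: is_subfield_def)

lemma is_subfield_uminus: "is_subfield K \<Longrightarrow> x \<in> K \<Longrightarrow> - x \<in> K"
  using is_subfieldD(4)[of K 0 x] is_subfieldD(1)[of K] by simp

lemma is_subspace_diff:
  assumes "is_subfield K" "is_subspace K W" "v \<in> W" "w \<in> W"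
  shows "v - w \<in> W"
proof -
  have "- 1 \<in> K" using assms(1) is_subfieldD(2) is_subfield_uminus by blast
  then have "v + sc (- 1) w \<in> W" using assms is_subspaceD by blast
  then show ?thesis by (simp add: sc_minus1)
qed

lemma is_subspace_fspan:
  assumes "is_subfield K"
  shows "is_subspace K (fspan K vs)"
  unfolding is_subspace_def
proof (intro conjI ballI)
  have "set (replicate (length vs) 0) \<subseteq> K" using is_subfieldD(1)[OF assms] by auto
  then show "0 \<in> fspan K vs"
    unfolding fspan_def using lcomb_replicate_0[of vs] by (metis (mono_tags, lifting) length_replicate mem_Collect_eq)
next
  fix v w assume "v \<in> fspan K vs" "w \<in> fspan K vs"
  then obtain cs ds where cs: "length cs = length vs" "set cs \<subseteq> K" "v = lcomb cs vs"
    and ds: "length ds = length vs" "set ds \<subseteq> K" "w = lcomb ds vs"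
    by (auto simp: fspan_def)
  have "set (map2 (+) cs ds) \<subseteq> K"
    using cs ds by (force dest: set_zip_leftD set_zip_rightD intro: is_subfieldD(3)[OF assms])
  then show "v + w \<in> fspan K vs"
    using lcomb_add[of cs vs ds] cs ds unfolding fspan_def
    by (intro CollectI exI[of _ "map2 (+) cs ds"]) auto
next
  fix c v assume "c \<in> K" "v \<in> fspan K vs"
  then obtain cs where cs: "length cs = length vs" "set cs \<subseteq> K" "v = lcomb cs vs"
    by (auto simp: fspan_def)
  then show "sc c v \<in> fspan K vs"
    using lcomb_scale[of cs vs c] is_subfieldD(5)[OF assms \<open>c \<in> K\<close>] unfolding fspan_def
    by (intro CollectI exI[of _ "map ((*) c) cs"]) auto
qed

lemma fspan_subset:
  assumes "is_subspace K W" "set vs \<subseteq> W"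
  shows "fspan K vs \<subseteq> W"
proof -
  have "lcomb cs vs \<in> W" if "length cs = length vs" "set cs \<subseteq> K" for cs
    using that assms(2)
  proof (induction vs arbitrary: cs)
    case (Cons v vs)
    then show ?case using is_subspaceD[OF assms(1)] by (cases cs) auto
  qed (auto simp: is_subspaceD[OF assms(1)])
  then show ?thesis by (auto simp: fspan_def)
qed

text \<open>Independence, applied to the difference of two coefficient lists, makes coordinates
  unique.\<close>

lemma card_fspan:
  fixes K :: "'a::{field,finite} set"
  assumes K: "is_subfield K" and "findep K vs"
  shows "card (fspan K vs) = card K ^ length vs"
proof -
  let ?C = "{cs. set cs \<subseteq> K \<and> length cs = length vs}"
  have "inj_on (\<lambda>cs. lcomb cs vs) ?C"
  proof (rule inj_onI)
    fix cs ds assume cs: "cs \<in> ?C" and ds: "ds \<in> ?C" and eq: "lcomb cs vs = lcomb ds vs"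
    let ?es = "map2 (-) cs ds"
    have "set ?es \<subseteq> K"
      using cs ds by (force dest: set_zip_leftD set_zip_rightD intro: is_subfieldD(4)[OF K])
    moreover have "lcomb ?es vs = (0, 0)"
      using lcomb_diff[of cs vs ds] cs ds eq by (simp add: zero_prod_def)
    moreover have "length ?es = length vs" using cs ds by simp
    ultimately have "\<forall>c\<in>set ?es. c = 0"
      using \<open>findep K vs\<close> unfolding findep_def by blast
    then have "\<forall>i < length vs. cs ! i = ds ! i"
      using cs ds by (auto simp: all_set_conv_all_nth)
    then show "cs = ds" using cs ds by (auto intro: nth_equalityI)
  qed
  moreover have "fspan K vs = (\<lambda>cs. lcomb cs vs) ` ?C" by (auto simp: fspan_def)
  ultimately show ?thesis by (simp add: card_image card_lists_length_eq)
qed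

lemma findep_Cons:
  assumes K: "is_subfield K" and indep: "findep K vs" and w: "w \<notin> fspan K vs"
  shows "findep K (w # vs)"
  unfolding findep_def
proof (intro allI impI)
  fix cs' assume cs': "length cs' = length (w # vs) \<and> set cs' \<subseteq> K \<and> lcomb cs' (w # vs) = (0, 0)"
  then obtain c cs where [simp]: "cs' = c # cs" by (cases cs') auto
  have cs: "length cs = length vs" "set cs \<subseteq> K" "c \<in> K" using cs' by auto
  have eq: "sc c w + lcomb cs vs = 0" using cs' by (simp add: zero_prod_def)
  have "c = 0"
  \<comment> \<open>With \<open>c \<noteq> 0\<close> the relation can be solved for
    \<open>w\<close>.\<close>
  proof (rule ccontr)
    assume "c \<noteq> 0"
    have "w = sc (1 / c) (sc c w)" using \<open>c \<noteq> 0\<close> by (simp add: sc_sc)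
    also have "sc c w = sc (- 1) (lcomb cs vs)" using eq by (simp add: sc_minus1 eq_neg_iff_add_eq_0)
    also have "sc (1 / c) \<dots> = sc (- 1 / c) (lcomb cs vs)" by (simp add: sc_sc)
    also have "\<dots> \<in> fspan K vs"
    proof (rule is_subspaceD(3)[OF is_subspace_fspan[OF K]])
      show "- 1 / c \<in> K" using K cs by (meson is_subfieldD is_subfield_uminus)
      show "lcomb cs vs \<in> fspan K vs" using cs by (auto simp: fspan_def)
    qed
    finally show False using w by simp
  qed
  then have "lcomb cs vs = (0, 0)" using eq by (simp add: zero_prod_def)
  then show "\<forall>c\<in>set cs'. c = 0"
    using indep cs \<open>c = 0\<close> unfolding findep_def by auto
qed

lemma card_subfield_ge_2:
  fixes K :: "'a::{field,finite} set"
  assumes "is_subfield K"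
  shows "card K \<ge> 2"
proof -
  have "card {0, 1 :: 'a} \<le> card K"
    using is_subfieldD[OF assms] by (intro card_mono) auto
  then show ?thesis by simp
qed

text \<open>Turns every later dimension argument into counting. For the converse, a longest
  independent list in \<open>W\<close> spans \<open>W\<close> by \<open>findep_Cons\<close>, and the
  size of \<open>W\<close> fixes its length.\<close>

lemma fdim_iff_card:
  fixes K :: "'a::{field,finite} set"
  assumes K: "is_subfield K"
  shows "fdim K W d \<longleftrightarrow> is_subspace K W \<and> card W = card K ^ d"
proof
  assume "fdim K W d"
  then show "is_subspace K W \<and> card W = card K ^ d"
    using card_fspan[OF K] is_subspace_fspan[OF K] by (auto simp: fdim_def)
next
  assume W: "is_subspace K W \<and> card W = card K ^ d"
  let ?P = "\<lambda>vs. findep K vs \<and> set vs \<subseteq> W"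
  have 1: "?P []" by (auto simp: findep_def)
  \<comment> \<open>Some bound on the lengths is required for a longest list to exist.\<close>
  have 2: "\<forall>vs. ?P vs \<longrightarrow> length vs < card W"
  proof (intro allI impI)
    fix vs assume vs: "?P vs"
    have "length vs < 2 ^ length vs" by simp
    also have "(2::nat) ^ length vs \<le> card K ^ length vs"
      using card_subfield_ge_2[OF K] by (intro power_mono) auto
    also have "\<dots> \<le> card W"
      using card_mono[OF _ fspan_subset[of K W vs]] card_fspan[OF K, of vs] vs W by simp
    finally show "length vs < card W" .
  qed
  obtain vs where vs: "?P vs" and max: "\<And>ws. ?P ws \<Longrightarrow> length ws \<le> length vs"
    using ex_has_greatest_nat[of ?P _ length, OF 1 2] by auto
  have span: "fspan K vs = W"
  proof (rule ccontr)
    assume "fspan K vs \<noteq> W"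
    then obtain w where "w \<in> W" "w \<notin> fspan K vs" using fspan_subset[of K W vs] W vs by auto
    then have "?P (w # vs)" using findep_Cons[OF K] vs by auto
    from max[OF this] show False by simp
  qed
  then have "card K ^ length vs = card K ^ d" using card_fspan[OF K, of vs] vs W by simp
  then have "length vs = d" using card_subfield_ge_2[OF K] by simp
  then show "fdim K W d" using span vs by (auto simp: fdim_def)
qed

section \<open>Sublines of the projective line\<close>

text \<open>For \<open>v \<noteq> 0\<close> this is the element of \<open>Dspread q n\<close>
  through \<open>v\<close>; for \<open>v = 0\<close> it degenerates to \<open>{0}\<close>.\<close>

definition fline :: "'a::field \<times> 'a \<Rightarrow> ('a \<times> 'a) set" where
  "fline v = range (\<lambda>x. sc x v)"

lemma fline_self: "v \<in> fline v"
  unfolding fline_def by (metis rangeI sc_1)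

lemma zero_in_fline: "0 \<in> fline v"
  unfolding fline_def by (metis rangeI sc_0_left)

lemma fline_sc: "c \<noteq> 0 \<Longrightarrow> fline (sc c v) = fline v"
proof -
  assume c: "c \<noteq> 0"
  have "sc x v = sc (x / c) (sc c v)" for x using c by (simp add: sc_sc)
  then have "fline v \<subseteq> fline (sc c v)" unfolding fline_def by blast
  moreover have "fline (sc c v) \<subseteq> fline v" unfolding fline_def sc_sc by blast
  ultimately show "fline (sc c v) = fline v" by (rule antisym[rotated])
qed

lemma fline_eqI:
  assumes "w \<in> fline v" "w \<noteq> 0"
  shows "fline w = fline v"
proof -
  obtain c where c: "w = sc c v" using assms(1) unfolding fline_def by blast
  with assms(2) have "c \<noteq> 0" by auto
  then show ?thesis using fline_sc c by simp
qed

lemma fline_inter: "fline v \<noteq> fline w \<Longrightarrow> fline v \<inter> fline w = {0}"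
  using fline_eqI[of _ v] fline_eqI[of _ w] zero_in_fline by blast

lemma is_subspace_fline: "is_subspace K (fline v)"
proof -
  have "sc x v + sc y v \<in> fline v" for x y by (metis fline_def rangeI sc_add_left)
  then show ?thesis using zero_in_fline[of v] by (auto simp: is_subspace_def fline_def sc_sc)
qed

lemma inj_on_sc: "v \<noteq> 0 \<Longrightarrow> inj_on (\<lambda>x. sc x v) T"
  by (rule inj_onI) (metis eq_iff_diff_eq_0 sc_diff_left sc_eq_0_iff)

lemma card_fline: "v \<noteq> 0 \<Longrightarrow> card (fline v :: ('a::{field,finite} \<times> 'a) set) = card (UNIV :: 'a set)"
  unfolding fline_def by (simp add: card_image inj_on_sc)

text \<open>The scalars range over the whole field, unlike in \<open>findep\<close>: this says that
  \<open>a\<close> and \<open>b\<close> represent distinct points of PG(1, q^n).\<close>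

definition indep :: "'a::field \<times> 'a \<Rightarrow> 'a \<times> 'a \<Rightarrow> bool" where
  "indep a b \<longleftrightarrow> (\<forall>s t. sc s a + sc t b = 0 \<longrightarrow> s = 0 \<and> t = 0)"

lemma indep_nonzero:
  assumes "indep a b" shows "a \<noteq> 0" "b \<noteq> 0" "a + b \<noteq> 0"
  using assms unfolding indep_def by (metis add.right_neutral add.left_neutral sc_0_left sc_0_right sc_1 zero_neq_one)+

lemma indep_eq_iff:
  assumes "indep a b"
  shows "sc s a + sc t b = sc s' a + sc t' b \<longleftrightarrow> s = s' \<and> t = t'"
proof
  assume "sc s a + sc t b = sc s' a + sc t' b"
  then have "sc (s - s') a + sc (t - t') b = 0" by (simp add: sc_diff_left algebra_simps)
  then show "s = s' \<and> t = t'" using assms unfolding indep_def by force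
qed auto

lemma indepI_fline:
  assumes "a \<noteq> 0" "b \<noteq> 0" "fline a \<noteq> fline b"
  shows "indep a b"
  unfolding indep_def
proof (intro allI impI)
  fix s t assume eq: "sc s a + sc t b = 0"
  then have "sc s a = sc (- t) b" by (metis add_eq_0_iff2 mult_minus1 sc_minus1 sc_sc)
  then have "sc s a \<in> fline a \<inter> fline b" unfolding fline_def by (metis IntI rangeI)
  then have "sc s a = 0" using fline_inter[OF assms(3)] by auto
  then show "s = 0 \<and> t = 0" using assms eq by auto
qed

lemma indep_sc: "indep a b \<Longrightarrow> s \<noteq> 0 \<Longrightarrow> t \<noteq> 0 \<Longrightarrow> indep (sc s a) (sc t b)"
  unfolding indep_def sc_sc by (metis mult_eq_0_iff)

lemma indep_commute: "indep a b \<longleftrightarrow> indep b a"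
  unfolding indep_def by (metis add.commute)

lemma indep_fline_neq:
  assumes "indep a b" shows "fline a \<noteq> fline b"
proof
  assume "fline a = fline b"
  then obtain x where "a = sc x b" using fline_self[of a] by (auto simp: fline_def)
  then have "sc 1 a + sc (- x) b = 0" by (metis add.right_inverse sc_0_left sc_1 sc_add_left)
  then show False using assms unfolding indep_def by (metis zero_neq_one)
qed

definition pspan :: "'a::field set \<Rightarrow> 'a \<times> 'a \<Rightarrow> 'a \<times> 'a \<Rightarrow> ('a \<times> 'a) set" where
  "pspan K a b = {sc s a + sc t b | s t. s \<in> K \<and> t \<in> K}"

lemma pspanE:
  assumes "v \<in> pspan K a b"
  obtains s t where "s \<in> K" "t \<in> K" "v = sc s a + sc t b"
  using assms unfolding pspan_def by blast

lemma card_pspan: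
  assumes "indep a b"
  shows "card (pspan K a b) = card K ^ 2"
proof -
  have "pspan K a b = (\<lambda>(s, t). sc s a + sc t b) ` (K \<times> K)" by (auto simp: pspan_def)
  moreover have "inj_on (\<lambda>(s, t). sc s a + sc t b) (K \<times> K)"
    using indep_eq_iff[OF assms] by (auto simp: inj_on_def)
  ultimately show ?thesis by (simp add: card_image power2_eq_square card_cartesian_product)
qed

lemma is_subspace_pspan:
  assumes "is_subfield K"
  shows "is_subspace K (pspan K a b)"
  unfolding is_subspace_def
proof (intro conjI ballI)
  show "0 \<in> pspan K a b" using is_subfieldD(1)[OF assms] by (force simp: pspan_def)
next
  fix v w assume "v \<in> pspan K a b" "w \<in> pspan K a b"
  then obtain s t s' t' where 1: "s \<in> K" "t \<in> K" "s' \<in> K" "t' \<in> K"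
    "v = sc s a + sc t b" "w = sc s' a + sc t' b" by (auto simp: pspan_def)
  then have "v + w = sc (s + s') a + sc (t + t') b" by (simp add: sc_add_left)
  then show "v + w \<in> pspan K a b" using 1 is_subfieldD(3)[OF assms] by (auto simp: pspan_def)
next
  fix c v assume "c \<in> K" "v \<in> pspan K a b"
  then obtain s t where 1: "s \<in> K" "t \<in> K" "v = sc s a + sc t b" by (auto simp: pspan_def)
  then have "sc c v = sc (c * s) a + sc (c * t) b" by (simp add: sc_add_right sc_sc)
  then show "sc c v \<in> pspan K a b" using 1 \<open>c \<in> K\<close> is_subfieldD(5)[OF assms] by (auto simp: pspan_def)
qed

lemma pspan_subset: "is_subspace K W \<Longrightarrow> a \<in> W \<Longrightarrow> b \<in> W \<Longrightarrow> pspan K a b \<subseteq> W"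
  unfolding pspan_def by (blast intro: is_subspaceD)

lemma pspan_eq:
  fixes K :: "'a::{field,finite} set"
  assumes "is_subspace K W" "a \<in> W" "b \<in> W" "indep a b" "card W = card K ^ 2"
  shows "pspan K a b = W"
  using assms by (intro card_subset_eq pspan_subset) (auto simp: card_pspan)

lemma pspan_UNIV:
  fixes a b :: "'a::{field,finite} \<times> 'a"
  assumes "indep a b"
  obtains s t where "v = sc s a + sc t b"
proof -
  have "card (UNIV :: ('a \<times> 'a) set) = card (UNIV :: 'a set) ^ 2"
    using card_cartesian_product[of "UNIV :: 'a set" "UNIV :: 'a set"] by (simp add: power2_eq_square)
  then have "pspan UNIV a b = UNIV"
    using assms by (intro pspan_eq) (auto simp: is_subspace_def)
  then show ?thesis using that by (force simp: pspan_def)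
qed

text \<open>For a subfield \<open>K\<close> and independent \<open>a\<close>, \<open>b\<close>, the
  \<open>K\<close>-subline of PG(1, q^n) with reference points \<open>fline a\<close>,
  \<open>fline b\<close> and unit point \<open>fline (a + b)\<close>.\<close>

definition subline :: "'a::field set \<Rightarrow> 'a \<times> 'a \<Rightarrow> 'a \<times> 'a \<Rightarrow> ('a \<times> 'a) set set" where
  "subline K a b = fline ` (pspan K a b - {0})"

text \<open>Dividing by the coefficient of \<open>b\<close>, where it is nonzero, gives the affine
  coordinate \<open>t\<close>; \<open>fline a\<close> is the point at infinity.\<close>

lemma subline_altdef:
  assumes K: "is_subfield K" and ab: "indep a b"
  shows "subline K a b = insert (fline a) ((\<lambda>t. fline (sc t a + b)) ` K)"
proof (rule antisym)
  show "subline K a b \<subseteq> insert (fline a) ((\<lambda>t. fline (sc t a + b)) ` K)"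
  proof
    fix X assume "X \<in> subline K a b"
    then obtain s t where st: "s \<in> K" "t \<in> K" "X = fline (sc s a + sc t b)" "sc s a + sc t b \<noteq> 0"
      unfolding subline_def pspan_def by blast
    show "X \<in> insert (fline a) ((\<lambda>t. fline (sc t a + b)) ` K)"
    proof (cases "t = 0")
      case True
      then show ?thesis using st fline_sc[of s a] by auto
    next
      case False
      then have "sc s a + sc t b = sc t (sc (s / t) a + b)" by (simp add: sc_add_right sc_sc)
      then have "X = fline (sc (s / t) a + b)" using st fline_sc[OF False] by simp
      then show ?thesis using is_subfieldD(6)[OF K] st by auto
    qed
  qed
next
  have "a \<in> pspan K a b"
    unfolding pspan_def using is_subfieldD(1,2)[OF K]
    by (intro CollectI exI[of _ 1] exI[of _ 0]) simp
  moreover have "sc t a + b \<in> pspan K a b" if "t \<in> K" for t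
    unfolding pspan_def using is_subfieldD(2)[OF K] that
    by (intro CollectI exI[of _ t] exI[of _ 1]) simp
  moreover have "sc t a + b \<noteq> 0" for t using ab unfolding indep_def by (metis sc_1 zero_neq_one)
  ultimately show "insert (fline a) ((\<lambda>t. fline (sc t a + b)) ` K) \<subseteq> subline K a b"
    using indep_nonzero(1)[OF ab] by (auto simp: subline_def)
qed

lemma inj_fline_affine:
  assumes "indep a b" shows "inj_on (\<lambda>t. fline (sc t a + b)) T"
proof (rule inj_onI)
  fix s t assume "fline (sc s a + b) = fline (sc t a + b)"
  then obtain x where "sc s a + b = sc x (sc t a + b)"
    using fline_self[of "sc s a + b"] unfolding fline_def by blast
  then have "sc s a + sc 1 b = sc (x * t) a + sc x b" by (simp add: sc_add_right sc_sc)
  then show "s = t" unfolding indep_eq_iff[OF assms] by simp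
qed

lemma fline_affine_neq:
  assumes "indep a b" shows "fline (sc t a + b) \<noteq> fline a"
proof
  assume "fline (sc t a + b) = fline a"
  then obtain x where "sc t a + b = sc x a"
    using fline_self[of "sc t a + b"] by (auto simp: fline_def)
  then have "sc t a + sc 1 b = sc x a + sc 0 b" by simp
  then show False unfolding indep_eq_iff[OF assms] by simp
qed

lemma card_subline:
  fixes a :: "'a::{field,finite} \<times> 'a"
  assumes "is_subfield K" "indep a b"
  shows "card (subline K a b) = card K + 1"
proof -
  have "fline a \<notin> (\<lambda>t. fline (sc t a + b)) ` K" using fline_affine_neq[OF assms(2)] by auto
  then show ?thesis
    using assms by (simp add: subline_altdef card_image inj_fline_affine)
qed

text \<open>A vector of the third point is a combination of vectors of the other two, and its
  coefficients are absorbed into \<open>a\<close> and \<open>b\<close>.\<close>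

lemma fline_frame:
  fixes A B C :: "('a::{field,finite} \<times> 'a) set"
  assumes "A \<in> fline ` (- {0})" "B \<in> fline ` (- {0})" "C \<in> fline ` (- {0})"
    and "A \<noteq> B" "A \<noteq> C" "B \<noteq> C"
  obtains a b where "indep a b" "A = fline a" "B = fline b" "C = fline (a + b)"
proof -
  obtain u v w where uvw: "u \<noteq> 0" "v \<noteq> 0" "w \<noteq> 0" "A = fline u" "B = fline v" "C = fline w"
    using assms(1-3) by blast
  then have uv: "indep u v" using assms(4) by (intro indepI_fline) auto
  then obtain s t where w: "w = sc s u + sc t v" using pspan_UNIV by blast
  \<comment> \<open>A zero coefficient would make \<open>C\<close> equal to \<open>A\<close> or
    \<open>B\<close>.\<close>
  have "s \<noteq> 0" "t \<noteq> 0" using w uvw assms(5,6) fline_sc[of s u] fline_sc[of t v] by auto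
  then show thesis using that[of "sc s u" "sc t v"] uv uvw w by (simp add: fline_sc indep_sc)
qed

section \<open>Reguli\<close>

text \<open>The parameter \<open>ty\<close> lets an interpretation fix the field type.\<close>

locale pg_tower =
  fixes ty :: "'a::{field,finite} itself" and p e q n k :: nat
  assumes prime_p: "prime p" and e1: "e \<ge> 1" and q_def: "q = p ^ e" and q2: "q > 2" and n1: "n \<ge> 1"
    and card_UNIV: "card (UNIV :: 'a set) = q ^ n" and k_dvd_n: "k dvd n"
begin

abbreviation Fq :: "'a set" where "Fq \<equiv> subfld q 1"
abbreviation Fk :: "'a set" where "Fk \<equiv> subfld q k"

lemma subfield_Fq: "is_subfield Fq" and subfield_Fk: "is_subfield Fk"
  using is_subfield_subfld[OF card_UNIV q_def prime_p] by auto

lemma card_Fq: "card Fq = q" and card_Fk: "card Fk = q ^ k"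
  using card_subfld[OF card_UNIV] q2 n1 k_dvd_n by auto

lemma k_pos: "k > 0"
  using k_dvd_n n1 by (intro Nat.gr0I) auto

lemma Fq_subset_Fk: "Fq \<subseteq> Fk"
proof
  fix x :: 'a assume "x \<in> Fq"
  then have x: "x ^ q = x" by (simp add: subfld_def)
  have "x ^ (q ^ k) = x" by (induction k) (simp_all add: x power_mult mult.commute)
  then show "x \<in> Fk" by (simp add: subfld_def)
qed

lemma fdim_Fq: "fdim Fq W d \<longleftrightarrow> is_subspace Fq W \<and> card W = q ^ d"
  using fdim_iff_card[OF subfield_Fq] card_Fq by simp

lemma Dspread_n: "(Dspread q n :: ('a \<times> 'a) set set) = fline ` (- {0})"
proof -
  have "subfld q n = (UNIV :: 'a set)"
    by (simp add: subfld_def power_card_UNIV flip: card_UNIV)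
  then have "(Dspread q n :: ('a \<times> 'a) set set) = {fline (a, b) | a b. (a, b) \<noteq> (0, 0)}"
    by (simp add: Dspread_def fline_def sc_def full_SetCompr_eq mult.commute)
  then show ?thesis by (force simp: zero_prod_def)
qed

lemma meets_iff:
  assumes "is_subspace Fq L"
  shows "meets L (fline v) \<longleftrightarrow> (\<exists>x. x \<noteq> 0 \<and> v \<noteq> 0 \<and> sc x v \<in> L)"
proof -
  have "0 \<in> L \<inter> fline v" using is_subspaceD(1)[OF assms] zero_in_fline by blast
  then have "meets L (fline v) \<longleftrightarrow> (\<exists>w. w \<in> L \<inter> fline v \<and> w \<noteq> 0)"
    unfolding meets_def zero_prod_def by blast
  also have "\<dots> \<longleftrightarrow> (\<exists>x. sc x v \<in> L \<and> sc x v \<noteq> 0)" unfolding fline_def by blast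
  finally show ?thesis by auto
qed

text \<open>A line \<open>L\<close> meeting three elements contains a multiple
  \<open>\<gamma> W\<close>, with \<open>\<gamma> \<noteq> 0\<close>, of
  \<open>W = pspan Fq a b\<close>. Hence it meets \<open>fline z\<close> for every nonzero
  \<open>z\<close> in \<open>W\<close>.\<close>

lemma is_regulus_subline:
  fixes a b :: "'a \<times> 'a"
  assumes ab: "indep a b"
  shows "is_regulus q n (subline Fq a b)"
  unfolding is_regulus_def
proof (intro conjI ballI allI impI)
  show "card (subline Fq a b) = q + 1" using card_subline[OF subfield_Fq ab] card_Fq by simp
next
  fix X assume "X \<in> subline Fq a b"
  then obtain v where "X = fline v" "v \<noteq> 0" unfolding subline_def by blast
  then show "fdim Fq X n"
    unfolding fdim_Fq by (simp add: is_subspace_fline card_fline card_UNIV)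
next
  fix X Y assume "X \<in> subline Fq a b" "Y \<in> subline Fq a b" "X \<noteq> Y"
  then show "X \<inter> Y = {(0, 0)}"
    using fline_inter unfolding subline_def zero_prod_def[symmetric] by blast
next
  fix L X
  assume L: "fdim Fq L 2" and X: "X \<in> subline Fq a b"
    and ex: "\<exists>A\<in>subline Fq a b. \<exists>B\<in>subline Fq a b. \<exists>C\<in>subline Fq a b.
      A \<noteq> B \<and> A \<noteq> C \<and> B \<noteq> C \<and> meets L A \<and> meets L B \<and> meets L C"
  let ?W = "pspan Fq a b"
  have W: "is_subspace Fq ?W" and cW: "card ?W = q ^ 2"
    using is_subspace_pspan[OF subfield_Fq] card_pspan[OF ab] card_Fq by auto
  have subL: "is_subspace Fq L" and cL: "card L = q ^ 2" using L fdim_Fq by auto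
  obtain u v w where uvw: "u \<in> ?W" "v \<in> ?W" "w \<in> ?W" "u \<noteq> 0" "v \<noteq> 0" "w \<noteq> 0"
    "fline u \<noteq> fline v" "fline u \<noteq> fline w" "fline v \<noteq> fline w"
    and m: "meets L (fline u)" "meets L (fline v)" "meets L (fline w)"
  proof -
    obtain A B C where ABC: "A \<in> subline Fq a b" "B \<in> subline Fq a b" "C \<in> subline Fq a b"
      "A \<noteq> B" "A \<noteq> C" "B \<noteq> C" "meets L A" "meets L B" "meets L C"
      using ex by metis
    obtain u v w where "u \<in> ?W - {0}" "v \<in> ?W - {0}" "w \<in> ?W - {0}"
      and [simp]: "A = fline u" "B = fline v" "C = fline w"
      using ABC(1-3) unfolding subline_def image_iff by metis
    then show thesis using that[of u v w] ABC by simp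
  qed
  obtain \<alpha> \<beta> \<gamma> where greek: "\<alpha> \<noteq> 0" "\<beta> \<noteq> 0" "\<gamma> \<noteq> 0" "sc \<alpha> u \<in> L" "sc \<beta> v \<in> L" "sc \<gamma> w \<in> L"
    using m unfolding meets_iff[OF subL] by metis
  have uv: "indep u v" using uvw indepI_fline by blast
  have span_uv: "pspan Fq u v = ?W"
    using W uvw uv cW card_Fq by (intro pspan_eq) auto
  have span_L: "pspan Fq (sc \<alpha> u) (sc \<beta> v) = L"
    using subL greek cL card_Fq indep_sc[OF uv] by (intro pspan_eq) auto
  obtain x y where xy: "x \<in> Fq" "y \<in> Fq" "w = sc x u + sc y v"
    using \<open>w \<in> ?W\<close> span_uv pspanE by metis
  have "x \<noteq> 0"
  proof
    assume "x = 0"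
    then have "w = sc y v" using xy by simp
    then show False using uvw(6,9) fline_sc[of y v] by (cases "y = 0") auto
  qed
  have "y \<noteq> 0"
  proof
    assume "y = 0"
    then have "w = sc x u" using xy by simp
    then show False using uvw(6,8) fline_sc[of x u] by (cases "x = 0") auto
  qed
  obtain s t where st: "s \<in> Fq" "t \<in> Fq" "sc \<gamma> w = sc s (sc \<alpha> u) + sc t (sc \<beta> v)"
    using \<open>sc \<gamma> w \<in> L\<close> span_L pspanE by metis
  have "sc (\<gamma> * x) u + sc (\<gamma> * y) v = sc (s * \<alpha>) u + sc (t * \<beta>) v"
    using st(3) unfolding xy(3) by (simp add: sc_add_right sc_sc)
  then have *: "\<gamma> * x = s * \<alpha>" "\<gamma> * y = t * \<beta>" unfolding indep_eq_iff[OF uv] by auto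
  \<comment> \<open>Scaling \<open>\<alpha> u\<close> and \<open>\<beta> v\<close> by these elements
    of \<open>Fq\<close> stays in \<open>L\<close> and gives \<open>\<gamma> u\<close> and
    \<open>\<gamma> v\<close>, so that one scalar serves both.\<close>
  have "s / x \<in> Fq" "t / y \<in> Fq" using st xy is_subfieldD(6)[OF subfield_Fq] by auto
  then have "sc (s / x) (sc \<alpha> u) \<in> L" "sc (t / y) (sc \<beta> v) \<in> L"
    using is_subspaceD(3)[OF subL] greek by auto
  moreover have "s / x * \<alpha> = \<gamma>" "t / y * \<beta> = \<gamma>"
    using * \<open>x \<noteq> 0\<close> \<open>y \<noteq> 0\<close> by (simp_all add: field_simps)
  ultimately have \<gamma>: "sc \<gamma> u \<in> L" "sc \<gamma> v \<in> L" by (simp_all add: sc_sc)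
  obtain z where z: "z \<in> ?W" "z \<noteq> 0" "X = fline z" using X unfolding subline_def by blast
  then obtain x' y' where z': "x' \<in> Fq" "y' \<in> Fq" "z = sc x' u + sc y' v"
    using span_uv pspanE by metis
  then have "sc \<gamma> z = sc x' (sc \<gamma> u) + sc y' (sc \<gamma> v)"
    by (simp add: sc_add_right sc_sc mult.commute)
  also have "\<dots> \<in> L" using \<gamma> z' is_subspaceD[OF subL] by blast
  finally show "meets L X" using z greek meets_iff[OF subL] by blast
qed

text \<open>Elements of \<open>R\<close> are a priori arbitrary \<open>n\<close>-dimensional
  \<open>Fq\<close>-subspaces. An element \<open>X\<close> other than \<open>fline a\<close> meets
  each line spanned by \<open>\<alpha> a\<close> and \<open>\<alpha> b\<close> in a vector that
  scales to \<open>\<alpha> (f \<alpha> a + b)\<close> with \<open>f \<alpha> \<in> Fq\<close>. Once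
  \<open>f\<close> is shown to be constant, \<open>X\<close> contains, and by size equals, a single
  \<open>fline (t a + b)\<close>.\<close>

lemma regulus_subset_subline:
  fixes a b :: "'a \<times> 'a"
  assumes ab: "indep a b" and R: "is_regulus q n R" "fline a \<in> R" "fline b \<in> R" "fline (a + b) \<in> R"
  shows "R \<subseteq> subline Fq a b"
proof
  fix X assume X: "X \<in> R"
  have dim: "is_subspace Fq X" "card X = q ^ n"
    and disj: "\<And>Y Z. Y \<in> R \<Longrightarrow> Z \<in> R \<Longrightarrow> Y \<noteq> Z \<Longrightarrow> Y \<inter> Z = {0}"
    and trans: "\<And>L A B C. fdim Fq L 2 \<Longrightarrow> A \<in> R \<Longrightarrow> B \<in> R \<Longrightarrow> C \<in> R \<Longrightarrow> A \<noteq> B \<Longrightarrow> A \<noteq> C \<Longrightarrow> B \<noteq> C \<Longrightarrow>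
      meets L A \<Longrightarrow> meets L B \<Longrightarrow> meets L C \<Longrightarrow> meets L X"
  proof -
    show "is_subspace Fq X" "card X = q ^ n"
      using R(1) X unfolding is_regulus_def fdim_Fq by simp_all
    show "Y \<inter> Z = {0}" if "Y \<in> R" "Z \<in> R" "Y \<noteq> Z" for Y Z
      using R(1) that unfolding is_regulus_def zero_prod_def by simp
    show "meets L X" if "fdim Fq L 2" "A \<in> R" "B \<in> R" "C \<in> R" "A \<noteq> B" "A \<noteq> C" "B \<noteq> C"
      "meets L A" "meets L B" "meets L C" for L A B C
    proof -
      have "\<exists>A\<in>R. \<exists>B\<in>R. \<exists>C\<in>R. A \<noteq> B \<and> A \<noteq> C \<and> B \<noteq> C \<and> meets L A \<and> meets L B \<and> meets L C"
        by (rule bexI[of _ A], rule bexI[of _ B], rule bexI[of _ C]) (use that in simp_all)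
      moreover have "\<forall>L. fdim Fq L 2 \<longrightarrow>
          (\<exists>A\<in>R. \<exists>B\<in>R. \<exists>C\<in>R. A \<noteq> B \<and> A \<noteq> C \<and> B \<noteq> C \<and> meets L A \<and> meets L B \<and> meets L C)
          \<longrightarrow> (\<forall>X\<in>R. meets L X)"
        using R(1) unfolding is_regulus_def by (elim conjE)
      ultimately show ?thesis using X that(1) by metis
    qed
  qed
  show "X \<in> subline Fq a b"
  proof (cases "X = fline a")
    case True
    then show ?thesis unfolding subline_altdef[OF subfield_Fq ab] by blast
  next
    case False
    have inter: "X \<inter> fline a = {0}" using disj[OF X R(2) False] .
    have neq: "fline a \<noteq> fline b" "fline a \<noteq> fline (a + b)" "fline b \<noteq> fline (a + b)"
      using indep_fline_neq[OF ab] fline_affine_neq[OF ab, of 1]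
        fline_affine_neq[of b a 1] indep_commute[of a b] ab by (auto simp: add.commute)
    have "\<exists>f\<in>Fq. sc \<alpha> (sc f a + b) \<in> X" if "\<alpha> \<noteq> 0" for \<alpha>
    proof -
      let ?L = "pspan Fq (sc \<alpha> a) (sc \<alpha> b)"
      have L: "is_subspace Fq ?L" "card ?L = q ^ 2"
        using is_subspace_pspan[OF subfield_Fq] card_pspan[OF indep_sc[OF ab that that]] card_Fq by auto
      have 01: "0 \<in> Fq" "1 \<in> Fq" using is_subfieldD[OF subfield_Fq] by auto
      have "sc \<alpha> a \<in> ?L" using 01 unfolding pspan_def
        by (intro CollectI exI[of _ 1] exI[of _ 0]) simp
      moreover have "sc \<alpha> b \<in> ?L" using 01 unfolding pspan_def
        by (intro CollectI exI[of _ 0] exI[of _ 1]) simp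
      moreover have "sc \<alpha> (a + b) \<in> ?L" using 01 unfolding pspan_def
        by (intro CollectI exI[of _ 1] exI[of _ 1]) (simp add: sc_add_right)
      ultimately have "meets ?L (fline a)" "meets ?L (fline b)" "meets ?L (fline (a + b))"
        using that indep_nonzero[OF ab] unfolding meets_iff[OF L(1)] by blast+
      from trans[OF _ R(2-4) neq this] have "meets ?L X" using L fdim_Fq by blast
      moreover have "0 \<in> ?L \<inter> X" using is_subspaceD(1) L dim by blast
      ultimately obtain w where "w \<in> ?L" "w \<in> X" "w \<noteq> 0"
        unfolding meets_def zero_prod_def by blast
      then obtain s t where st: "s \<in> Fq" "t \<in> Fq" "w = sc s (sc \<alpha> a) + sc t (sc \<alpha> b)"
        using pspanE by metis
      \<comment> \<open>Otherwise the common vector lies on \<open>fline a\<close>, which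
        \<open>X\<close> meets only in 0.\<close>
      have "t \<noteq> 0"
      proof
        assume "t = 0"
        then have "w \<in> fline a" using st by (simp add: sc_sc fline_def)
        then show False using inter \<open>w \<in> X\<close> \<open>w \<noteq> 0\<close> by blast
      qed
      have "1 / t \<in> Fq" "s / t \<in> Fq" using st 01 is_subfieldD(6)[OF subfield_Fq] by auto
      moreover from this have "sc (1 / t) w \<in> X" using is_subspaceD(3)[OF dim(1)] \<open>w \<in> X\<close> by blast
      moreover have "sc (1 / t) w = sc \<alpha> (sc (s / t) a + b)"
        using \<open>t \<noteq> 0\<close> unfolding st(3) by (simp add: sc_add_right sc_sc mult.commute)
      ultimately show ?thesis by metis
    qed
    then obtain f where f: "\<And>\<alpha>. \<alpha> \<noteq> 0 \<Longrightarrow> f \<alpha> \<in> Fq" "\<And>\<alpha>. \<alpha> \<noteq> 0 \<Longrightarrow> sc \<alpha> (sc (f \<alpha>) a + b) \<in> X"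
      by metis
    \<comment> \<open>Two vectors of \<open>X\<close> with the same coordinate along
      \<open>b\<close> differ by a vector of \<open>fline a\<close>; thus \<open>X\<close> is the
      graph of a function of that coordinate.\<close>
    have uniq: "x = y" if "sc x a + sc \<beta> b \<in> X" "sc y a + sc \<beta> b \<in> X" for x y \<beta>
    proof -
      have "sc (x - y) a \<in> X"
        using is_subspace_diff[OF subfield_Fq dim(1) that] by (simp add: sc_diff_left)
      then have "sc (x - y) a = 0" using inter unfolding fline_def by blast
      then show ?thesis using indep_nonzero(1)[OF ab] by simp
    qed
    have f': "sc (\<alpha> * f \<alpha>) a + sc \<alpha> b \<in> X" if "\<alpha> \<noteq> 0" for \<alpha>
      using f(2)[OF that] by (simp add: sc_add_right sc_sc)
    text \<open>\<open>\<alpha> \<mapsto> \<alpha> * f \<alpha>\<close> is additive with every nonzero element an eigenvector over \<open>Fq\<close>, hence a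
      homothety.\<close>
    have f_scale: "f (c * \<beta>) = f \<beta>" if "c \<in> Fq" "c \<noteq> 0" "\<beta> \<noteq> 0" for c \<beta>
    proof -
      have "sc c (sc (\<beta> * f \<beta>) a + sc \<beta> b) \<in> X"
        using is_subspaceD(3)[OF dim(1)] that f' by blast
      then have "sc (c * (\<beta> * f \<beta>)) a + sc (c * \<beta>) b \<in> X" by (simp add: sc_add_right sc_sc)
      from uniq[OF this f'[of "c * \<beta>"]] that show ?thesis by simp
    qed
    have const: "f \<alpha> = f \<beta>" if nz: "\<alpha> \<noteq> 0" "\<beta> \<noteq> 0" for \<alpha> \<beta>
    proof (cases "\<alpha> / \<beta> \<in> Fq")
      case True
      then show ?thesis using f_scale[of "\<alpha> / \<beta>" \<beta>] nz by simp
    next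
      case False
      have "- 1 \<in> Fq"
        using subfield_Fq is_subfieldD(2) is_subfield_uminus by blast
      then have sum: "\<alpha> + \<beta> \<noteq> 0" using False nz
        by (metis add_eq_0_iff2 divide_minus_left divide_self)
      \<comment> \<open>Adding the vectors for \<open>\<alpha>\<close> and \<open>\<beta>\<close>
        and comparing with the one for \<open>\<alpha> + \<beta>\<close> gives
        \<open>\<alpha> * (f \<alpha> - ?g) = \<beta> * (?g - f \<beta>)\<close>. Both differences
        lie in \<open>Fq\<close> but \<open>\<alpha> / \<beta>\<close> does not, so both
        vanish.\<close>
      let ?g = "f (\<alpha> + \<beta>)"
      have "(sc (\<alpha> * f \<alpha>) a + sc \<alpha> b) + (sc (\<beta> * f \<beta>) a + sc \<beta> b) \<in> X"
        using is_subspaceD(2)[OF dim(1)] f' nz by blast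
      then have "sc (\<alpha> * f \<alpha> + \<beta> * f \<beta>) a + sc (\<alpha> + \<beta>) b \<in> X" by (simp add: sc_add_left algebra_simps)
      from uniq[OF this f'[OF sum]] have "\<alpha> * (f \<alpha> - ?g) = \<beta> * (?g - f \<beta>)"
        by (simp add: algebra_simps)
      moreover have "(?g - f \<beta>) / (f \<alpha> - ?g) \<in> Fq"
        by (intro is_subfieldD(4,6)[OF subfield_Fq] f(1) nz sum)
      moreover have "\<alpha> / \<beta> = (?g - f \<beta>) / (f \<alpha> - ?g)" if "f \<alpha> \<noteq> ?g"
        using calculation(1) that nz by (subst frac_eq_eq) (simp_all only: mult.commute right_minus_eq not_False_eq_True)
      ultimately have "f \<alpha> = ?g" using False by metis
      then show ?thesis using \<open>\<alpha> * (f \<alpha> - ?g) = \<beta> * (?g - f \<beta>)\<close> nz by simp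
    qed
    let ?v = "sc (f 1) a + b"
    have "sc \<alpha> ?v \<in> X" for \<alpha>
      using f(2)[of \<alpha>] const[of \<alpha> 1] is_subspaceD(1)[OF dim(1)] by (cases "\<alpha> = 0") auto
    then have "fline ?v \<subseteq> X" unfolding fline_def by blast
    moreover have "?v \<noteq> 0" using ab unfolding indep_def by (metis sc_1 zero_neq_one)
    ultimately have "X = fline ?v" using dim(2) card_fline[of ?v] card_UNIV
      by (metis card_subset_eq finite_code)
    then have "X \<in> (\<lambda>t. fline (sc t a + b)) ` Fq"
      by (rule image_eqI[where x = "f 1"]) (simp only: f(1) one_neq_zero not_False_eq_True)
    then show ?thesis unfolding subline_altdef[OF subfield_Fq ab] by (rule insertI2)
  qed
qed

end

section \<open>The equivalences\<close>

text \<open>The harmonic operation first yields \<open>x^2 / s\<close> and then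
  \<open>x^2 * s\<close> for \<open>x\<close>, \<open>s\<close> in \<open>T\<close>. Products follow
  by polarising squares when 2 is invertible, and otherwise because every element of
  \<open>T\<close> is a square of one in \<open>T\<close>.\<close>

lemma mult_closed_of_harmonic_closed:
  fixes T :: "'a::{field,finite} set"
  assumes T1: "1 \<in> T" and T0: "0 \<in> T" and add: "\<And>x y. x \<in> T \<Longrightarrow> y \<in> T \<Longrightarrow> x + y \<in> T"
    and neg: "\<And>x. x \<in> T \<Longrightarrow> - x \<in> T"
    and harm: "\<And>x y. x \<in> T \<Longrightarrow> y \<in> T \<Longrightarrow> x \<noteq> 0 \<Longrightarrow> y \<noteq> 0 \<Longrightarrow> x + y \<noteq> 0 \<Longrightarrow> x * y / (x + y) \<in> T"
    and "x \<in> T" "y \<in> T"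
  shows "x * y \<in> T"
proof -
  have diff: "x - y \<in> T" if "x \<in> T" "y \<in> T" for x y
    using add[OF that(1) neg[OF that(2)]] by simp
  have sq_div: "x\<^sup>2 / s \<in> T" if "x \<in> T" "s \<in> T" "s \<noteq> 0" for x s
  proof (cases "x = 0 \<or> x = s")
    case True
    then show ?thesis using that T0 by (auto simp: power2_eq_square)
  next
    case False
    \<comment> \<open>The partner \<open>s - x\<close> makes the denominator \<open>s\<close> and
      the value \<open>x - x^2 / s\<close>.\<close>
    then have "x * (s - x) / (x + (s - x)) \<in> T"
      using that by (intro harm diff) auto
    then have "x - x * (s - x) / s \<in> T" using that diff by simp
    moreover have "x - x * (s - x) / s = x\<^sup>2 / s" using that by (simp add: field_simps power2_eq_square)
    ultimately show ?thesis by simp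
  qed
  have sq_mult: "x\<^sup>2 * s \<in> T" if "x \<in> T" "s \<in> T" for x s
  proof (cases "s = 0")
    case False
    \<comment> \<open>Inverses are the case \<open>x = 1\<close> of \<open>sq_div\<close>; dividing
      \<open>x^2\<close> by \<open>1 / s\<close> then multiplies it by \<open>s\<close>.\<close>
    have "1 / s \<in> T" using sq_div[of 1 s] that T1 False by simp
    then show ?thesis using sq_div[of x "1 / s"] that False by simp
  qed (simp add: T0)
  show ?thesis
  proof (cases "(2 :: 'a) = 0")
    case False
    have sq: "z\<^sup>2 \<in> T" if "z \<in> T" for z using sq_div[of z 1] that T1 by simp
    have "1 + 1 \<in> T" using add T1 by blast
    then have "2 \<in> T" by simp
    then have half: "1 / 2 \<in> T" using sq_div[of 1 2] T1 False by simp
    have "(x + y)\<^sup>2 - x\<^sup>2 - y\<^sup>2 \<in> T" by (intro add diff sq \<open>x \<in> T\<close> \<open>y \<in> T\<close>)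
    then have "2 * (x * y) \<in> T" by (simp add: power2_sum algebra_simps)
    \<comment> \<open>So far only squares may be used as factors, so the 2 is removed by multiplying
      with the square of \<open>1 / 2\<close> and then doubling.\<close>
    then have *: "(1 / 2)\<^sup>2 * (2 * (x * y)) \<in> T" using sq_mult half by blast
    have "(1 / 2)\<^sup>2 * (2 * (x * y)) = 1 / 2 * (1 / 2 * 2) * (x * y)"
      by (simp only: power2_eq_square mult.assoc)
    also have "\<dots> = x * y / 2" using False by simp
    finally have "(1 / 2)\<^sup>2 * (2 * (x * y)) = x * y / 2" .
    then have "x * y / 2 + x * y / 2 \<in> T" using * add by metis
    moreover have "x * y / 2 + x * y / 2 = x * y"
      using False by (metis add_divide_distrib mult_2 nonzero_mult_div_cancel_left)
    ultimately show ?thesis by simp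
  next
    case True
    text \<open>In characteristic 2 squaring is injective, hence permutes \<open>T\<close>.\<close>
    have "inj_on (\<lambda>z. z\<^sup>2) T"
    proof (rule inj_onI)
      fix z w :: 'a assume "z\<^sup>2 = w\<^sup>2"
      then have "(z + w)\<^sup>2 = 0" by (simp add: power2_sum True flip: mult_2)
      then have "z + w + w = w" by simp
      then show "z = w" using True by (simp add: add.assoc flip: mult_2)
    qed
    moreover have "(\<lambda>z. z\<^sup>2) ` T \<subseteq> T" using sq_div[of _ 1] T1 by auto
    ultimately have "(\<lambda>z. z\<^sup>2) ` T = T" by (simp add: endo_inj_surj)
    then obtain z where "z \<in> T" "x = z\<^sup>2" using \<open>x \<in> T\<close> by blast
    then show ?thesis using sq_mult \<open>y \<in> T\<close> by simp
  qed
qed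

section \<open>Sublines of \<open>l_inf\<close> as sublines of PG(1, q^n)\<close>

lemma ppt_self: "w \<in> ppt w"
  unfolding ppt_def by (auto simp: sc3_def intro!: exI[of _ 1])

lemma ppt_in_l_inf:
  assumes "ppt (a, b, c) \<in> l_inf" shows "c = 0"
proof -
  obtain a' b' where "ppt (a, b, c) = ppt (a', b', 0)" using assms unfolding l_inf_def by blast
  then have "(a, b, c) \<in> ppt (a', b', 0)" using ppt_self by metis
  then show ?thesis by (auto simp: ppt_def sc3_def)
qed

lemma phi_ppt: "phi (ppt (fst v, snd v, 0)) = fline v"
proof (rule set_eqI, rule iffI)
  fix w assume "w \<in> phi (ppt (fst v, snd v, 0))"
  then obtain c x where "w = (c * fst v * x, c * snd v * x)"
    unfolding phi_def ppt_def sc3_def by auto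
  then have "w = sc (c * x) v" by (simp add: sc_def mult_ac)
  then show "w \<in> fline v" by (simp add: fline_def)
next
  fix w assume "w \<in> fline v"
  then obtain x where "w = (fst v * x, snd v * x)" by (auto simp: fline_def sc_def mult.commute)
  moreover have "(fst v, snd v, 0) \<in> ppt (fst v, snd v, 0)" by (rule ppt_self)
  ultimately show "w \<in> phi (ppt (fst v, snd v, 0))" unfolding phi_def by blast
qed

text \<open>Independence trades nonzero vectors for nonzero coefficient pairs, the form used in
  \<open>is_subline\<close>.\<close>

lemma subline_eq_Collect:
  assumes "indep a b"
  shows "subline K a b = {fline (sc s a + sc t b) | s t. s \<in> K \<and> t \<in> K \<and> (s, t) \<noteq> (0, 0)}"
proof -
  have *: "sc s a + sc t b \<noteq> 0 \<longleftrightarrow> (s, t) \<noteq> (0, 0)" for s t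
    using assms unfolding indep_def by auto
  have "subline K a b = {fline (sc s a + sc t b) | s t. s \<in> K \<and> t \<in> K \<and> sc s a + sc t b \<noteq> 0}"
    unfolding subline_def pspan_def by blast
  then show ?thesis unfolding * .
qed

definition lift3 :: "'a::field \<times> 'a \<Rightarrow> 'a \<times> 'a \<times> 'a" where
  "lift3 v = (fst v, snd v, 0)"

lemma vadd3_lift3: "vadd3 (sc3 s (lift3 a)) (sc3 t (lift3 b)) = lift3 (sc s a + sc t b)"
  by (simp add: lift3_def vadd3_def sc3_def sc_def)

lemma lift3_eq_0_iff: "lift3 v = (0, 0, 0) \<longleftrightarrow> v = 0"
  by (auto simp: lift3_def prod_eq_iff)

lemma phi_ppt_lift3: "phi (ppt (lift3 v)) = fline v"
  unfolding lift3_def by (rule phi_ppt)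

text \<open>Removes the third coordinate from condition (1): the frame points of a subline inside
  \<open>l_inf\<close> lie on \<open>l_inf\<close> themselves, so both frame vectors are of the form
  \<open>lift3 a\<close>.\<close>

lemma ex_subline_iff:
  fixes S :: "('a::{field,finite} \<times> 'a) set set"
  assumes "is_subfield (subfld q k :: 'a set)"
  shows "(\<exists>m. is_subline q k m \<and> m \<subseteq> l_inf \<and> S = phi ` m) \<longleftrightarrow>
    (\<exists>a b. indep a b \<and> S = subline (subfld q k) a b)" (is "?L \<longleftrightarrow> ?R")
proof -
  let ?K = "subfld q k :: 'a set"
  let ?m = "\<lambda>a b. {ppt (vadd3 (sc3 s (lift3 a)) (sc3 t (lift3 b))) | s t. s \<in> ?K \<and> t \<in> ?K \<and> (s, t) \<noteq> (0, 0)}"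
  have phi_m: "phi ` ?m a b = subline ?K a b" if "indep a b" for a b
  proof -
    have "phi ` ?m a b = {phi (ppt (lift3 (sc s a + sc t b))) | s t. s \<in> ?K \<and> t \<in> ?K \<and> (s, t) \<noteq> (0, 0)}"
      unfolding vadd3_lift3 by blast
    then show ?thesis unfolding phi_ppt_lift3 subline_eq_Collect[OF that] .
  qed
  show ?thesis
  proof
    assume ?L
    then obtain m where "is_subline q k m" and sub: "m \<subseteq> l_inf" and S: "S = phi ` m" by blast
    then obtain u v where
      uv: "\<forall>\<alpha> \<beta>. vadd3 (sc3 \<alpha> u) (sc3 \<beta> v) = (0, 0, 0) \<longrightarrow> \<alpha> = 0 \<and> \<beta> = 0"
      and m: "m = {ppt (vadd3 (sc3 s u) (sc3 t v)) | s t. s \<in> ?K \<and> t \<in> ?K \<and> (s, t) \<noteq> (0, 0)}"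
      unfolding is_subline_def by (elim exE conjE) (rule that)
    obtain u1 u2 u3 v1 v2 v3 where [simp]: "u = (u1, u2, u3)" "v = (v1, v2, v3)"
      by (metis prod.collapse)
    have 01: "0 \<in> ?K" "1 \<in> ?K" using is_subfieldD[OF assms] by auto
    have "ppt (vadd3 (sc3 s u) (sc3 t v)) \<in> m" if "s \<in> ?K" "t \<in> ?K" "(s, t) \<noteq> (0, 0)" for s t
      unfolding m using that by blast
    \<comment> \<open>The parameters (1, 0) and (0, 1) give the points of \<open>u\<close> and
      \<open>v\<close>.\<close>
    from this[OF 01(2,1)] this[OF 01]
    have "ppt (vadd3 (sc3 1 u) (sc3 0 v)) \<in> m" "ppt (vadd3 (sc3 0 u) (sc3 1 v)) \<in> m"
      by simp_all
    then have "ppt u \<in> l_inf" "ppt v \<in> l_inf" using sub by (auto simp: vadd3_def sc3_def)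
    then have "u3 = 0" "v3 = 0" using ppt_in_l_inf by auto
    then have l: "u = lift3 (u1, u2)" "v = lift3 (v1, v2)" by (auto simp: lift3_def)
    have "indep (u1, u2) (v1, v2)"
      unfolding indep_def using uv unfolding l vadd3_lift3 lift3_eq_0_iff by blast
    moreover have "S = subline ?K (u1, u2) (v1, v2)"
      using phi_m[OF calculation] S m unfolding l by simp
    ultimately show ?R by blast
  next
    assume ?R
    then obtain a b where ab: "indep a b" "S = subline ?K a b" by blast
    have "is_subline q k (?m a b)"
      unfolding is_subline_def
    proof (intro exI conjI allI impI)
      show "?m a b = ?m a b" ..
      fix \<alpha> \<beta> assume "vadd3 (sc3 \<alpha> (lift3 a)) (sc3 \<beta> (lift3 b)) = (0, 0, 0)"
      then have "sc \<alpha> a + sc \<beta> b = 0" unfolding vadd3_lift3 lift3_eq_0_iff .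
      then show "\<alpha> = 0" "\<beta> = 0" using ab(1) unfolding indep_def by auto
    qed
    moreover have "?m a b \<subseteq> l_inf"
    proof
      fix P assume "P \<in> ?m a b"
      then obtain s t where st: "(s, t) \<noteq> (0, 0)" "P = ppt (lift3 (sc s a + sc t b))"
        unfolding vadd3_lift3 by blast
      then have "sc s a + sc t b \<noteq> 0" using ab(1) unfolding indep_def by blast
      then have "(fst (sc s a + sc t b), snd (sc s a + sc t b)) \<noteq> (0, 0)"
        by (auto simp: prod_eq_iff)
      then show "P \<in> l_inf" unfolding st(2) l_inf_def lift3_def by blast
    qed
    moreover have "S = phi ` ?m a b" unfolding phi_m[OF ab(1)] by (rule ab(2))
    ultimately show ?L by (intro exI[of _ "?m a b"] conjI)
  qed
qed

context pg_tower begin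

section \<open>From a subline to a subspace\<close>

text \<open>The intersection is the set of \<open>Fk\<close>-multiples of one vector
  \<open>w\<close>: if \<open>x w\<close> lies in the \<open>Fk\<close>-span, then \<open>x\<close>
  is a quotient of coordinates in \<open>Fk\<close>, taken where \<open>w\<close> has a nonzero
  coordinate.\<close>

lemma subline_section:
  fixes a b :: "'a \<times> 'a"
  assumes ab: "indep a b" and X: "X \<in> subline Fk a b"
  shows "card (pspan Fk a b \<inter> X) = q ^ k" "pspan Fk a b \<inter> X \<in> Dspread q k"
proof -
  let ?W = "pspan Fk a b"
  obtain w where w: "w \<in> ?W" "w \<noteq> 0" "X = fline w" using X unfolding subline_def by blast
  obtain s t where st: "s \<in> Fk" "t \<in> Fk" "w = sc s a + sc t b" using w(1) by (rule pspanE)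
  have "s \<noteq> 0 \<or> t \<noteq> 0" using st(3) w(2) by auto
  have "x \<in> Fk" if sc_w: "sc x w \<in> ?W" for x
  proof -
    obtain s' t' where st': "s' \<in> Fk" "t' \<in> Fk" "sc x w = sc s' a + sc t' b" using sc_w by (rule pspanE)
    then have "sc (x * s) a + sc (x * t) b = sc s' a + sc t' b"
      unfolding st(3) by (simp add: sc_add_right sc_sc)
    then have "x * s = s'" "x * t = t'" unfolding indep_eq_iff[OF ab] by auto
    then have "x = s' / s \<or> x = t' / t" using \<open>s \<noteq> 0 \<or> t \<noteq> 0\<close> by auto
    then show ?thesis using st st' is_subfieldD(6)[OF subfield_Fk] by blast
  qed
  moreover have "sc x w \<in> ?W" if "x \<in> Fk" for x
    using is_subspaceD(3)[OF is_subspace_pspan[OF subfield_Fk]] that w(1) by blast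
  ultimately have eq: "?W \<inter> X = (\<lambda>x. sc x w) ` Fk" unfolding w(3) fline_def by blast
  show "card (?W \<inter> X) = q ^ k" unfolding eq by (simp add: card_image inj_on_sc w(2) card_Fk)
  have "?W \<inter> X = {(fst w * x, snd w * x) | x. x \<in> Fk}"
    unfolding eq sc_def by (auto simp: mult.commute)
  moreover have "(fst w, snd w) \<noteq> (0, 0)" using w(2) by (auto simp: prod_eq_iff)
  ultimately show "?W \<inter> X \<in> Dspread q k" unfolding Dspread_def by blast
qed

lemma subspace_of_subline:
  fixes a b :: "'a \<times> 'a"
  assumes ab: "indep a b"
  shows "\<exists>W. fdim Fq W (2 * k) \<and>
    (\<forall>X\<in>subline Fk a b. fdim Fq (W \<inter> X) k \<and> W \<inter> X \<in> Dspread q k)"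
proof (intro exI[of _ "pspan Fk a b"] conjI ballI)
  have sub: "is_subspace Fq (pspan Fk a b)"
    using is_subspace_pspan[OF subfield_Fk] Fq_subset_Fk unfolding is_subspace_def by blast
  then show "fdim Fq (pspan Fk a b) (2 * k)"
    unfolding fdim_Fq using card_pspan[OF ab, of Fk] card_Fk by (simp add: power_mult mult.commute)
  fix X assume X: "X \<in> subline Fk a b"
  then obtain w where "X = fline w" unfolding subline_def by blast
  then have "is_subspace Fq (pspan Fk a b \<inter> X)"
    using sub is_subspace_fline[of Fq w] unfolding is_subspace_def by blast
  then show "fdim Fq (pspan Fk a b \<inter> X) k" "pspan Fk a b \<inter> X \<in> Dspread q k"
    unfolding fdim_Fq using subline_section[OF ab X] by blast+
qed

section \<open>From a subspace to closure under \<open>Fq\<close>-sublines\<close>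

text \<open>The \<open>q ^ k + 1\<close> disjoint sections of \<open>W\<close> have
  \<open>q ^ k - 1\<close> nonzero vectors each, \<open>q ^ (2 * k) - 1\<close> together, and so
  exhaust \<open>W - {0}\<close>.\<close>

lemma subspace_covered:
  fixes S :: "('a \<times> 'a) set set"
  assumes S: "S \<subseteq> fline ` (- {0})" "card S = q ^ k + 1"
    and W: "fdim Fq W (2 * k)" "\<And>X. X \<in> S \<Longrightarrow> fdim Fq (W \<inter> X) k"
    and w: "w \<in> W" "w \<noteq> 0"
  shows "fline w \<in> S"
proof -
  let ?P = "\<lambda>X. W \<inter> X - {0}"
  have disj: "?P X \<inter> ?P Y = {}" if XY: "X \<in> S" "Y \<in> S" "X \<noteq> Y" for X Y
  proof -
    obtain x y where "X = fline x" "Y = fline y" using XY S(1) by blast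
    then show ?thesis using fline_inter[of x y] XY by blast
  qed
  have cardP: "card (?P X) = q ^ k - 1" if "X \<in> S" for X
  proof -
    have "card (W \<inter> X) = q ^ k" "0 \<in> W \<inter> X"
      using W(2)[OF that] unfolding fdim_Fq is_subspace_def by blast+
    then show ?thesis by (simp add: card_Diff_singleton)
  qed
  have "finite S" using S(2) by (intro card_ge_0_finite) simp
  then have "card (\<Union>X\<in>S. ?P X) = (\<Sum>X\<in>S. card (?P X))"
    using disj by (intro card_UN_disjoint) auto
  also have "\<dots> = (q ^ k + 1) * (q ^ k - 1)" using cardP S(2) by simp
  also have "\<dots> = q ^ (2 * k) - 1"
    by (simp add: power_mult algebra_simps power2_eq_square flip: power_add)
  also have "\<dots> = card (W - {0})"
    using W(1) unfolding fdim_Fq is_subspace_def by (simp add: card_Diff_singleton)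
  finally have "(\<Union>X\<in>S. ?P X) = W - {0}" by (intro card_subset_eq) auto
  then obtain X where X: "X \<in> S" "w \<in> X" using w by blast
  then obtain v where "X = fline v" using S(1) by blast
  then show ?thesis using fline_eqI[of w v] X w by simp
qed

text \<open>By size \<open>W\<close> is the direct sum of its sections with \<open>fline a\<close>
  and \<open>fline b\<close>. A nonzero \<open>\<gamma> (a + b)\<close> in \<open>W\<close>
  therefore has both components \<open>\<gamma> a\<close>, \<open>\<gamma> b\<close> in
  \<open>W\<close>, so \<open>\<gamma> z\<close> is in \<open>W\<close> for every \<open>z\<close>
  in the \<open>Fq\<close>-span, and \<open>subspace_covered\<close> applies.\<close>

lemma subspace_imp_subline_subset:
  fixes a b :: "'a \<times> 'a"
  assumes S: "S \<subseteq> fline ` (- {0})" "card S = q ^ k + 1"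
    and W: "fdim Fq W (2 * k)" "\<And>X. X \<in> S \<Longrightarrow> fdim Fq (W \<inter> X) k"
    and ab: "indep a b" "fline a \<in> S" "fline b \<in> S" "fline (a + b) \<in> S"
  shows "subline Fq a b \<subseteq> S"
proof
  fix X assume "X \<in> subline Fq a b"
  then obtain z where z: "z \<in> pspan Fq a b" "z \<noteq> 0" "X = fline z" unfolding subline_def by blast
  have subW: "is_subspace Fq W" and cW: "card W = q ^ (2 * k)" using W(1) fdim_Fq by auto
  have cWX: "card (W \<inter> Y) = q ^ k" if "Y \<in> S" for Y using W(2)[OF that] fdim_Fq by auto
  \<comment> \<open>Scalar coordinates of the two sections; each set has \<open>q ^ k\<close>
    elements, and their product matches \<open>card W\<close>.\<close>
  let ?U = "{x. sc x a \<in> W}" and ?V = "{x. sc x b \<in> W}"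
  have "W \<inter> fline a = (\<lambda>x. sc x a) ` ?U" "W \<inter> fline b = (\<lambda>x. sc x b) ` ?V"
    unfolding fline_def by blast+
  then have cU: "card ?U = q ^ k" and cV: "card ?V = q ^ k"
    using cWX[OF ab(2)] cWX[OF ab(3)] by (simp_all add: card_image inj_on_sc indep_nonzero[OF ab(1)])
  have inj: "inj_on (\<lambda>(x, y). sc x a + sc y b) (?U \<times> ?V)"
    using indep_eq_iff[OF ab(1)] by (auto simp: inj_on_def)
  have "(\<lambda>(x, y). sc x a + sc y b) ` (?U \<times> ?V) \<subseteq> W"
    by (clarsimp simp del: split_paired_All) (rule is_subspaceD(2)[OF subW])
  moreover have "card ((\<lambda>(x, y). sc x a + sc y b) ` (?U \<times> ?V)) = card W"
    unfolding card_image[OF inj] card_cartesian_product cU cV cW by (simp add: mult_2 power_add)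
  ultimately have im: "(\<lambda>(x, y). sc x a + sc y b) ` (?U \<times> ?V) = W"
    by (intro card_subset_eq) auto
  have "card (W \<inter> fline (a + b)) > 1" using cWX[OF ab(4)] one_less_power[of q k] q2 k_pos by simp
  then have "\<not> W \<inter> fline (a + b) \<subseteq> {0}" using card_mono[of "{0}" "W \<inter> fline (a + b)"] by auto
  then obtain \<gamma> where \<gamma>: "sc \<gamma> (a + b) \<in> W" "sc \<gamma> (a + b) \<noteq> 0" unfolding fline_def by blast
  then obtain x y where xy: "sc x a \<in> W" "sc y b \<in> W" "sc \<gamma> (a + b) = sc x a + sc y b"
    using im by (force simp del: sc_eq_0_iff)
  then have "sc \<gamma> a + sc \<gamma> b = sc x a + sc y b" by (simp add: sc_add_right)
  then have "sc \<gamma> a \<in> W" "sc \<gamma> b \<in> W" unfolding indep_eq_iff[OF ab(1)] using xy by auto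
  obtain s t where st: "s \<in> Fq" "t \<in> Fq" "z = sc s a + sc t b" using z(1) by (rule pspanE)
  have "sc \<gamma> z = sc s (sc \<gamma> a) + sc t (sc \<gamma> b)" unfolding st(3) by (simp add: sc_add_right sc_sc mult.commute)
  also have "\<dots> \<in> W" using st \<open>sc \<gamma> a \<in> W\<close> \<open>sc \<gamma> b \<in> W\<close> is_subspaceD(2,3)[OF subW] by metis
  finally have "sc \<gamma> z \<in> W" .
  moreover have "\<gamma> \<noteq> 0" using \<gamma>(2) by auto
  ultimately have "fline (sc \<gamma> z) \<in> S" using z(2) by (intro subspace_covered[OF S W]) auto
  then show "X \<in> S" using fline_sc[OF \<open>\<gamma> \<noteq> 0\<close>] z(3) by simp
qed

section \<open>From closure under \<open>Fq\<close>-sublines to a subline\<close>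

text \<open>Here \<open>T\<close> collects the affine coordinates of the points of \<open>S\<close>
  other than \<open>fline a\<close>. The \<open>Fq\<close>-subline through infinity,
  \<open>x\<close> and \<open>y\<close> has affine part \<open>x + \<mu> (y - x)\<close>, so
  \<open>T\<close> contains the affine \<open>Fq\<close>-line through any two of its
  elements.\<close>

lemma affine_param_add_closed:
  fixes a b :: "'a \<times> 'a"
  assumes closed: "\<forall>c d. indep c d \<longrightarrow> fline c \<in> S \<longrightarrow> fline d \<in> S \<longrightarrow> fline (c + d) \<in> S \<longrightarrow>
      subline Fq c d \<subseteq> S"
    and ab: "indep a b" "fline a \<in> S" "fline b \<in> S"
  defines "T \<equiv> {t. fline (sc t a + b) \<in> S}"
  shows "\<And>x \<mu>. x \<in> T \<Longrightarrow> \<mu> \<in> Fq \<Longrightarrow> \<mu> * x \<in> T" "\<And>x y. x \<in> T \<Longrightarrow> y \<in> T \<Longrightarrow> x + y \<in> T"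
proof -
  have line: "x + \<mu> * (y - x) \<in> T" if xy: "x \<in> T" "y \<in> T" and \<mu>: "\<mu> \<in> Fq" for x y \<mu>
  proof (cases "x = y")
    case False
    \<comment> \<open>Scaling \<open>a\<close> by \<open>y - x\<close> makes \<open>?c + ?d\<close>
      the vector of the point \<open>y\<close>, so that infinity, \<open>x\<close> and
      \<open>y\<close> form the frame.\<close>
    let ?c = "sc (y - x) a" and ?d = "sc x a + b"
    have sum: "?c + ?d = sc y a + b" by (simp add: sc_diff_left)
    have c: "fline ?c = fline a" using False by (simp add: fline_sc)
    have "?d \<noteq> 0" using ab(1) unfolding indep_def by (metis sc_1 zero_neq_one)
    then have cd: "indep ?c ?d"
      using False indep_nonzero[OF ab(1)] fline_affine_neq[OF ab(1), of x] c by (intro indepI_fline) auto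
    have "subline Fq ?c ?d \<subseteq> S"
      using cd c ab(2) xy by (intro closed[rule_format]) (simp_all only: sum T_def mem_Collect_eq)
    then have "fline (sc \<mu> ?c + ?d) \<in> S" using \<mu> unfolding subline_altdef[OF subfield_Fq cd] by blast
    moreover have "sc \<mu> ?c + ?d = sc (x + \<mu> * (y - x)) a + b" by (simp add: sc_sc sc_add_left mult.commute flip: add.assoc)
    ultimately show ?thesis by (simp add: T_def)
  qed (use xy in simp)
  have T0: "0 \<in> T" using ab(3) by (simp add: T_def)
  show scale: "\<mu> * x \<in> T" if "x \<in> T" "\<mu> \<in> Fq" for x \<mu>
    using line[OF T0 that] by simp
  \<comment> \<open>This is where \<open>q > 2\<close> enters: a scalar \<open>\<mu>\<close> with
    both \<open>\<mu>\<close> and \<open>1 - \<mu>\<close> nonzero exists.\<close>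
  have "\<not> Fq \<subseteq> {0, 1}"
  proof
    assume "Fq \<subseteq> {0, 1}"
    then have "card Fq \<le> card {0, 1 :: 'a}" by (intro card_mono) auto
    then show False using card_Fq q2 by simp
  qed
  then obtain \<mu> where \<mu>: "\<mu> \<in> Fq" "\<mu> \<noteq> 0" "\<mu> \<noteq> 1" by blast
  then have F: "1 / \<mu> \<in> Fq" "1 / (1 - \<mu>) \<in> Fq" "1 - \<mu> \<in> Fq"
    using is_subfieldD[OF subfield_Fq] by metis+
  fix x y assume "x \<in> T" "y \<in> T"
  \<comment> \<open>The affine combination of \<open>x / \<mu>\<close> and
    \<open>y / (1 - \<mu>)\<close> with weights \<open>\<mu>\<close> and \<open>1 - \<mu>\<close> is
    \<open>x + y\<close>.\<close>
  then have "1 / \<mu> * x + (1 - \<mu>) * (1 / (1 - \<mu>) * y - 1 / \<mu> * x) \<in> T" using F scale line by blast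
  moreover have "1 / \<mu> * x + (1 - \<mu>) * (1 / (1 - \<mu>) * y - 1 / \<mu> * x) = x + y"
    using \<mu> by (simp add: field_simps)
  ultimately show "x + y \<in> T" by simp
qed

text \<open>In the coordinate with \<open>fline a\<close> at infinity, \<open>S\<close> becomes
  \<open>?T\<close>; with \<open>fline b\<close> at infinity it becomes \<open>?T'\<close>. Both are
  additively closed and inversion exchanges their nonzero elements, which gives the harmonic closure
  of \<open>?T\<close> and hence its multiplicative closure.\<close>

lemma regulus_closed_imp_subline:
  fixes S :: "('a \<times> 'a) set set"
  assumes S: "S \<subseteq> fline ` (- {0})" "card S = q ^ k + 1"
    and closed: "\<forall>c d. indep c d \<longrightarrow> fline c \<in> S \<longrightarrow> fline d \<in> S \<longrightarrow> fline (c + d) \<in> S \<longrightarrow>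
      subline Fq c d \<subseteq> S"
  shows "\<exists>a b. indep a b \<and> S = subline Fk a b"
proof -
  have "3 \<le> card S" using S(2) self_le_power[of q k] q2 k_pos by simp
  then obtain S' where S': "S' \<subseteq> S" "card S' = 3" by (metis obtain_subset_with_card_n)
  obtain A B C where ABC: "S' = {A, B, C}" "A \<noteq> B" "B \<noteq> C" "A \<noteq> C"
    using S'(2) unfolding card_3_iff by metis
  then have mem: "A \<in> S" "B \<in> S" "C \<in> S" using S' by auto
  obtain a b where ab: "indep a b" and ABC': "A = fline a" "B = fline b" "C = fline (a + b)"
    using fline_frame[OF subsetD[OF S(1) mem(1)] subsetD[OF S(1) mem(2)] subsetD[OF S(1) mem(3)]
        ABC(2,4,3)] .
  have ba: "indep b a" using ab indep_commute by blast
  let ?T = "{t. fline (sc t a + b) \<in> S}" and ?T' = "{t. fline (sc t b + a) \<in> S}"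
  note T = affine_param_add_closed[OF closed ab mem(1,2)[unfolded ABC']]
  note T' = affine_param_add_closed[OF closed ba mem(2,1)[unfolded ABC']]
  \<comment> \<open>Swapping the two reference points inverts the affine coordinate.\<close>
  have inv: "1 / t \<in> ?T' \<longleftrightarrow> t \<in> ?T" if "t \<noteq> 0" for t
  proof -
    have "sc t a + b = sc t (sc (1 / t) b + a)" using that by (simp add: sc_add_right sc_sc add.commute)
    then show ?thesis using fline_sc[OF that] by simp
  qed
  have T0: "0 \<in> ?T" and T1: "1 \<in> ?T" using mem ABC' by simp_all
  have mult: "x * y \<in> ?T" if "x \<in> ?T" "y \<in> ?T" for x y
  proof (rule mult_closed_of_harmonic_closed[of ?T, OF T1 T0 _ _ _ that])
    show "x + y \<in> ?T" if "x \<in> ?T" "y \<in> ?T" for x y using T(2)[OF that] .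
    have "- 1 \<in> Fq" using subfield_Fq is_subfieldD(2) is_subfield_uminus by blast
    then show "- x \<in> ?T" if "x \<in> ?T" for x using T(1)[OF that, of "- 1"] by simp
    fix x y assume xy: "x \<in> ?T" "y \<in> ?T" "x \<noteq> 0" "y \<noteq> 0" "x + y \<noteq> 0"
    then have "1 / x + 1 / y \<in> ?T'" using T'(2) inv by blast
    moreover have "1 / x + 1 / y = 1 / (x * y / (x + y))" using xy by (simp add: field_simps)
    ultimately show "x * y / (x + y) \<in> ?T" using inv[of "x * y / (x + y)"] xy by simp
  qed
  have "fline ` (- {0}) = subline UNIV a b"
  proof -
    have "pspan UNIV a b = UNIV" using pspan_UNIV[OF ab] unfolding pspan_def by blast
    then show ?thesis unfolding subline_def by (simp add: Compl_eq_Diff_UNIV)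
  qed
  also have "\<dots> = insert (fline a) (range (\<lambda>t. fline (sc t a + b)))"
    by (rule subline_altdef) (use ab in \<open>auto simp: is_subfield_def\<close>)
  finally have "S \<subseteq> insert (fline a) (range (\<lambda>t. fline (sc t a + b)))" using S(1) by simp
  moreover have "S = insert z (g ` {t. g t \<in> S})" if "S \<subseteq> insert z (range g)" "z \<in> S"
    for z :: "('a \<times> 'a) set" and g :: "'a \<Rightarrow> _"
    using that by auto
  ultimately have S_eq: "S = insert (fline a) ((\<lambda>t. fline (sc t a + b)) ` ?T)"
    using mem(1) ABC'(1) by simp
  \<comment> \<open>The point at infinity is the extra 1 in \<open>card S = q ^ k + 1\<close>, which
    leaves \<open>q ^ k\<close> elements for \<open>?T\<close>.\<close>
  moreover have "fline a \<notin> (\<lambda>t. fline (sc t a + b)) ` ?T" using fline_affine_neq[OF ab] by blast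
  ultimately have "card S = Suc (card ((\<lambda>t. fline (sc t a + b)) ` ?T))"
    by (metis card_insert_disjoint finite_code)
  then have cT: "card ?T = q ^ k" using S(2) by (simp add: card_image inj_fline_affine[OF ab])
  \<comment> \<open>Multiplicative closure and the size of \<open>?T\<close> give
    \<open>x ^ (q ^ k) = x\<close>, the equation defining \<open>Fk\<close>.\<close>
  have "?T \<subseteq> Fk"
    using power_card_mult_closed[of ?T, OF mult T0] unfolding cT subfld_def by blast
  then have "?T = Fk" using cT card_Fk by (intro card_subset_eq) auto
  then have "S = subline Fk a b" using S_eq unfolding subline_altdef[OF subfield_Fk ab] by simp
  then show ?thesis using ab by blast
qed

text \<open>Rewrites condition (2) in terms of frames. From left to right the subline is itself a
  regulus through the three points; from right to left any regulus through them lies in that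
  subline.\<close>

lemma regulus_closed_iff:
  fixes S :: "('a \<times> 'a) set set"
  assumes S: "S \<subseteq> fline ` (- {0})"
  shows "(\<forall>A\<in>S. \<forall>B\<in>S. \<forall>C\<in>S. A \<noteq> B \<and> A \<noteq> C \<and> B \<noteq> C \<longrightarrow>
      (\<forall>R. is_regulus q n R \<and> {A, B, C} \<subseteq> R \<longrightarrow> R \<subseteq> S)) \<longleftrightarrow>
    (\<forall>a b. indep a b \<longrightarrow> fline a \<in> S \<longrightarrow> fline b \<in> S \<longrightarrow> fline (a + b) \<in> S \<longrightarrow> subline Fq a b \<subseteq> S)"
    (is "?L \<longleftrightarrow> ?R")
proof
  assume L: ?L
  show ?R
  proof (intro allI impI)
    fix a b :: "'a \<times> 'a"
    assume ab: "indep a b" "fline a \<in> S" "fline b \<in> S" "fline (a + b) \<in> S"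
    have 1: "fline a \<noteq> fline b" "fline a \<noteq> fline (a + b)" "fline b \<noteq> fline (a + b)"
      using indep_fline_neq[OF ab(1)] fline_affine_neq[OF ab(1), of 1]
        fline_affine_neq[of b a 1] indep_commute[of a b] ab(1) by (auto simp: add.commute)
    have 01: "0 \<in> Fq" "1 \<in> Fq" using is_subfieldD[OF subfield_Fq] by auto
    have "fline (sc t a + b) \<in> subline Fq a b" if "t \<in> Fq" for t
      using that unfolding subline_altdef[OF subfield_Fq ab(1)] by blast
    from this[OF 01(1)] this[OF 01(2)] have "{fline a, fline b, fline (a + b)} \<subseteq> subline Fq a b"
      unfolding subline_altdef[OF subfield_Fq ab(1)] by simp
    then show "subline Fq a b \<subseteq> S" using L 1 ab(2-4) is_regulus_subline[OF ab(1)] by metis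
  qed
next
  assume R: ?R
  show ?L
  proof (intro ballI allI impI)
    fix A B C R' assume *: "A \<in> S" "B \<in> S" "C \<in> S" "A \<noteq> B \<and> A \<noteq> C \<and> B \<noteq> C"
      "is_regulus q n R' \<and> {A, B, C} \<subseteq> R'"
    then have ne: "A \<noteq> B" "A \<noteq> C" "B \<noteq> C" by simp_all
    obtain a b where ab: "indep a b" "A = fline a" "B = fline b" "C = fline (a + b)"
      using fline_frame[OF subsetD[OF S *(1)] subsetD[OF S *(2)] subsetD[OF S *(3)] ne] .
    then have "R' \<subseteq> subline Fq a b" using * by (intro regulus_subset_subline) auto
    also have "\<dots> \<subseteq> S"
      using R[rule_format, OF ab(1)] *(1-3) unfolding ab(2-4) by simp
    finally show "R' \<subseteq> S" .
  qed
qed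

end

theorem theorem2p10:
  fixes q n k :: nat and S :: "('a::{field,finite} \<times> 'a) set set"
  assumes "\<exists>p e. prime p \<and> e \<ge> 1 \<and> q = p ^ e"
    and "q > 2" and "n \<ge> 1" and "card (UNIV :: 'a set) = q ^ n" and "k dvd n"
    and "S \<subseteq> Dspread q n" and "card S = q ^ k + 1"
  shows "let
      c1 = (\<exists>m. is_subline q k m \<and> m \<subseteq> (l_inf :: ('a \<times> 'a \<times> 'a) set set) \<and> S = phi ` m);
      c2 = (\<forall>A\<in>S. \<forall>B\<in>S. \<forall>C\<in>S. A \<noteq> B \<and> A \<noteq> C \<and> B \<noteq> C \<longrightarrow>
              (\<forall>R. is_regulus q n R \<and> {A, B, C} \<subseteq> R \<longrightarrow> R \<subseteq> S));
      c3 = (\<exists>W. fdim (subfld q 1) W (2 * k) \<and> (\<forall>X\<in>S. fdim (subfld q 1) (W \<inter> X) k));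
      c4 = (\<exists>W. fdim (subfld q 1) W (2 * k) \<and>
              (\<forall>X\<in>S. fdim (subfld q 1) (W \<inter> X) k \<and> W \<inter> X \<in> Dspread q k))
    in (c1 \<longleftrightarrow> c2) \<and> (c1 \<longleftrightarrow> c3) \<and> (c1 \<longleftrightarrow> c4)"
proof -
  obtain p e where "prime p" "e \<ge> 1" "q = p ^ e" using assms(1) by blast
  then interpret pg_tower "TYPE('a)" p e q n k using assms by unfold_locales
  have S: "S \<subseteq> fline ` (- {0})" using assms(6) Dspread_n by simp
  define c1 where "c1 = (\<exists>m. is_subline q k m \<and> m \<subseteq> (l_inf :: ('a \<times> 'a \<times> 'a) set set) \<and> S = phi ` m)"
  define c2 where "c2 = (\<forall>A\<in>S. \<forall>B\<in>S. \<forall>C\<in>S. A \<noteq> B \<and> A \<noteq> C \<and> B \<noteq> C \<longrightarrow>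
              (\<forall>R. is_regulus q n R \<and> {A, B, C} \<subseteq> R \<longrightarrow> R \<subseteq> S))"
  define c3 where "c3 = (\<exists>W. fdim (subfld q 1) W (2 * k) \<and> (\<forall>X\<in>S. fdim (subfld q 1) (W \<inter> X) k))"
  define c4 where "c4 = (\<exists>W. fdim (subfld q 1) W (2 * k) \<and>
              (\<forall>X\<in>S. fdim (subfld q 1) (W \<inter> X) k \<and> W \<inter> X \<in> Dspread q k))"
  have c1: "c1 \<longleftrightarrow> (\<exists>a b. indep a b \<and> S = subline Fk a b)"
    unfolding c1_def by (rule ex_subline_iff[OF subfield_Fk])
  \<comment> \<open>The equivalences follow from the cycle \<open>c1\<close>, \<open>c4\<close>,
    \<open>c3\<close>, \<open>c2\<close>, \<open>c1\<close>.\<close>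
  have "c1 \<Longrightarrow> c4" unfolding c1 c4_def using subspace_of_subline by metis
  moreover have "c4 \<Longrightarrow> c3" unfolding c4_def c3_def by blast
  moreover have "c3 \<Longrightarrow> c2"
    unfolding c3_def c2_def regulus_closed_iff[OF S]
    using subspace_imp_subline_subset[OF S assms(7)] by metis
  moreover have "c2 \<Longrightarrow> c1"
    unfolding c2_def regulus_closed_iff[OF S] c1
    using regulus_closed_imp_subline[OF S assms(7)] by metis
  ultimately have "(c1 \<longleftrightarrow> c2) \<and> (c1 \<longleftrightarrow> c3) \<and> (c1 \<longleftrightarrow> c4)" by blast
  then show ?thesis unfolding Let_def c1_def c2_def c3_def c4_def .
qed

end
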